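(* Let $N=n_1=n_2$, and let $T_N=T_N(Z_1,\dots,Z_N)$ be a two-sample statistic viewed as a function of the pairs $Z_j=(X_{1j},X_{2j})$, satisfying $$T_N=\frac1N\sum_{j=1}^N\xi(Z_j)+R_N,\qquad \xi(z)=\tfrac12[h_1(z_1)+h_2(z_2)],\quad z=(z_1,z_2)\in\mathbb R^2,$$ with $E\,\xi(Z_1)=0$, $\int h_i^4\,dF_i<\infty$ for $i=1,2$, and $N E(R_N^2)=o(1)$, $N^2E(R_N-R_{N-1})^2=o(1)$ as $N\to\infty$. Then the jackknife estimators $$\widehat\sigma_N^2(T)=(N-1)\sum_{i=1}^N\big(T_{N,-i}-\overline{T_{N,-\bullet}}\big)^2\quad\text{and}\quad \widehat{\mathrm{Var}}(T_N)=\frac{N-1}{N}\sum_{i=1}^N\big(T_{N,-i}-\overline{T_{N,-\bullet}}\big)^2$$ of $\sigma^2(T)$ and $\mathrm{Var}(T_N)$, respectively, are consistent and asymptotically unbiased: $\widehat\sigma_N^2(T)/\sigma^2(T)\to1$ in probability, $E\,\widehat\sigma_N^2(T)/\sigma^2(T)\to1$, $\widehat{\mathrm{Var}}(T_N)/\mathrm{Var}(T_N)\to1$ in probability and $E\,\widehat{\mathrm{Var}}(T_N)/\mathrm{Var}(T_N)\to1$, as $N\to\infty$.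
   Context: Two independent i.i.d. samples $X_{ij}\sim F_i$, $j=1,\dots,N$, $i=1,2$. The statistic, computed from the two samples of equal size $N$, is symmetric in the observations of the first sample and symmetric in the observations of the second sample, and is defined for all $N$. $h_1,h_2$ do not depend on $N$. The leave-one-pair-out statistics are $T_{N,-i}=T_{N-1}(Z_1,\dots,Z_{i-1},Z_{i+1},\dots,Z_N)$, and $\overline{T_{N,-\bullet}}=\frac1N\sum_{i=1}^NT_{N,-i}$. The remainder $R_{N-1}$ is the one associated with $T_{N-1}(Z_1,\dots,Z_{N-1})$. With the pseudo values $\widehat\xi_i=NT_N-(N-1)T_{N,-i}$ one has $\widehat\sigma_N^2(T)=\frac1{N-1}\sum_{i=1}^N(\widehat\xi_i-\overline{\widehat\xi}_N)^2$, $\overline{\widehat\xi}_N=\frac1N\sum_{i=1}^N\widehat\xi_i$. The asymptotic variance is here $\sigma^2(T)=\lim_{N\to\infty}\mathrm{Var}(\sqrt N T_N)=\mathrm{Var}(\xi(Z_1))$, assumed to lie in $(0,\infty)$. *)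

theory Defs
  imports "HOL-Probability.Probability" "HOL-Combinatorics.Permutations"
begin

text \<open>
  The observations are \<open>X i j\<close> with sample index \<open>i \<in> {1, 2}\<close> and observation index \<open>j \<ge> 1\<close>.
  A point of \<open>(\<real> \<times> \<real>)\<^sup>N\<close> is an extensional function on \<open>{1..N}\<close>, i.e. an element of
  \<open>space (Pi\<^sub>M {1..N} (\<lambda>_. borel))\<close>; a statistic is a family \<open>T\<close> whose member \<open>T N\<close> is
  applied to such points.
\<close>

definition two_iid_samples ::
  "'a measure \<Rightarrow> (nat \<Rightarrow> real measure) \<Rightarrow> (nat \<Rightarrow> nat \<Rightarrow> 'a \<Rightarrow> real) \<Rightarrow> bool" where
  "two_iid_samples M F X \<longleftrightarrow>
     prob_space M \<and>
     prob_space.indep_vars M (\<lambda>_. borel) (\<lambda>(i, j). X i j) ({1, 2} \<times> {1..}) \<and>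
     (\<forall>i\<in>{1, 2}. \<forall>j\<ge>1. distr M borel (X i j) = F i)"

definition pair_obs :: "(nat \<Rightarrow> nat \<Rightarrow> 'a \<Rightarrow> real) \<Rightarrow> nat \<Rightarrow> 'a \<Rightarrow> real \<times> real" where
  "pair_obs X j \<omega> = (X 1 j \<omega>, X 2 j \<omega>)"

text \<open>The two samples may be permuted independently of each other.\<close>

definition two_sample_symmetric :: "nat \<Rightarrow> ((nat \<Rightarrow> real \<times> real) \<Rightarrow> real) \<Rightarrow> bool" where
  "two_sample_symmetric N t \<longleftrightarrow>
     (\<forall>p q z. p permutes {1..N} \<longrightarrow> q permutes {1..N} \<longrightarrow> z \<in> extensional {1..N} \<longrightarrow>
        t (\<lambda>j\<in>{1..N}. (fst (z (p j)), snd (z (q j)))) = t z)"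

definition two_sample_statistic :: "(nat \<Rightarrow> (nat \<Rightarrow> real \<times> real) \<Rightarrow> real) \<Rightarrow> bool" where
  "two_sample_statistic T \<longleftrightarrow>
     (\<forall>N\<ge>1. T N \<in> borel_measurable (Pi\<^sub>M {1..N} (\<lambda>_. borel)) \<and> two_sample_symmetric N (T N))"

definition stat ::
  "(nat \<Rightarrow> (nat \<Rightarrow> real \<times> real) \<Rightarrow> real) \<Rightarrow> (nat \<Rightarrow> nat \<Rightarrow> 'a \<Rightarrow> real) \<Rightarrow> nat \<Rightarrow> 'a \<Rightarrow> real" where
  "stat T X N \<omega> = T N (\<lambda>j\<in>{1..N}. pair_obs X j \<omega>)"

text \<open>
  The \<open>N - 1\<close> pairs left after deleting the \<open>i\<close>-th one are renumbered \<open>1, \<dots>, N - 1\<close>.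
\<close>

definition stat_leave_out ::
  "(nat \<Rightarrow> (nat \<Rightarrow> real \<times> real) \<Rightarrow> real) \<Rightarrow> (nat \<Rightarrow> nat \<Rightarrow> 'a \<Rightarrow> real) \<Rightarrow> nat \<Rightarrow> nat \<Rightarrow> 'a \<Rightarrow> real" where
  "stat_leave_out T X N i \<omega> =
     T (N - 1) (\<lambda>j\<in>{1..N - 1}. pair_obs X (if j < i then j else j + 1) \<omega>)"

definition stat_leave_out_mean ::
  "(nat \<Rightarrow> (nat \<Rightarrow> real \<times> real) \<Rightarrow> real) \<Rightarrow> (nat \<Rightarrow> nat \<Rightarrow> 'a \<Rightarrow> real) \<Rightarrow> nat \<Rightarrow> 'a \<Rightarrow> real" where
  "stat_leave_out_mean T X N \<omega> = 1 / real N * (\<Sum>i=1..N. stat_leave_out T X N i \<omega>)"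

definition jackknife_sigma2 ::
  "(nat \<Rightarrow> (nat \<Rightarrow> real \<times> real) \<Rightarrow> real) \<Rightarrow> (nat \<Rightarrow> nat \<Rightarrow> 'a \<Rightarrow> real) \<Rightarrow> nat \<Rightarrow> 'a \<Rightarrow> real" where
  "jackknife_sigma2 T X N \<omega> =
     (real N - 1) * (\<Sum>i=1..N. (stat_leave_out T X N i \<omega> - stat_leave_out_mean T X N \<omega>)\<^sup>2)"

definition jackknife_var ::
  "(nat \<Rightarrow> (nat \<Rightarrow> real \<times> real) \<Rightarrow> real) \<Rightarrow> (nat \<Rightarrow> nat \<Rightarrow> 'a \<Rightarrow> real) \<Rightarrow> nat \<Rightarrow> 'a \<Rightarrow> real" where
  "jackknife_var T X N \<omega> =
     (real N - 1) / real N *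
       (\<Sum>i=1..N. (stat_leave_out T X N i \<omega> - stat_leave_out_mean T X N \<omega>)\<^sup>2)"

definition xi :: "(nat \<Rightarrow> real \<Rightarrow> real) \<Rightarrow> real \<times> real \<Rightarrow> real" where
  "xi h z = 1 / 2 * (h 1 (fst z) + h 2 (snd z))"

definition asymptotic_variance ::
  "'a measure \<Rightarrow> (nat \<Rightarrow> (nat \<Rightarrow> real \<times> real) \<Rightarrow> real) \<Rightarrow> (nat \<Rightarrow> nat \<Rightarrow> 'a \<Rightarrow> real) \<Rightarrow> real" where
  "asymptotic_variance M T X =
     lim (\<lambda>N. prob_space.variance M (\<lambda>\<omega>. sqrt (real N) * stat T X N \<omega>))"

definition tendsto_in_prob :: "'a measure \<Rightarrow> (nat \<Rightarrow> 'a \<Rightarrow> real) \<Rightarrow> real \<Rightarrow> bool" where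
  "tendsto_in_prob M Y c \<longleftrightarrow>
     (\<forall>\<epsilon>>0. (\<lambda>N. measure M {\<omega> \<in> space M. \<bar>Y N \<omega> - c\<bar> > \<epsilon>}) \<longlonglongrightarrow> 0)"

end

theory Submission
  imports Defs "HOL-Real_Asymp.Real_Asymp"
begin

text \<open>
  Write \<open>Y\<^sub>i = \<xi>(Z\<^sub>i)\<close>, \<open>s = E Y\<^sub>1\<^sup>2\<close>, and \<open>d\<^sub>i\<close> for the remainder of the statistic with the
  \<open>i\<close>-th pair deleted minus the remainder \<open>R\<^sub>N\<close> of the full statistic.  Deleting a pair changes the
  linear part by a multiple of \<open>Y\<^sub>i\<close>, so the jackknife estimator is exactly a sum of squares
  \<open>\<Sum>\<^sub>i (u\<^sub>i + v\<^sub>i)\<^sup>2\<close> with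
  \<open>u\<^sub>i = - (Y\<^sub>i - mean of Y) / sqrt (N - 1)\<close> and \<open>v\<^sub>i = sqrt (N - 1) (d\<^sub>i - mean of d)\<close>
  (\<open>jackknife_sum_squares\<close>).  The full remainder is a common shift of all leave-one-out values and
  cancels.

  The sum \<open>\<Sum>\<^sub>i u\<^sub>i\<^sup>2\<close> is the sample variance of the \<open>Y\<^sub>i\<close>; it tends to \<open>s\<close> in \<open>L\<^sup>1\<close>, since the
  fourth moments let one bound the error by second moments of centred independent sums
  (\<open>sample_variance_tendsto_L1\<close>).  The sum \<open>\<Sum>\<^sub>i v\<^sub>i\<^sup>2\<close> is at most \<open>(N - 1) \<Sum>\<^sub>i d\<^sub>i\<^sup>2\<close>.  Moving the
  deleted pair to the last place is a permutation of the sample, which neither the symmetric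
  statistic nor the distribution of the sample notices, so every \<open>d\<^sub>i\<close> is distributed like
  \<open>R\<^bsub>N-1\<^esub> - R\<^sub>N\<close> (\<open>delete_one_distr\<close>) and \<open>E \<Sum>\<^sub>i v\<^sub>i\<^sup>2 \<le> N\<^sup>2 E (R\<^sub>N - R\<^bsub>N-1\<^esub>)\<^sup>2 \<rightarrow> 0\<close>.  By Cauchy-Schwarz
  a perturbation whose expected squared length vanishes does not change the \<open>L\<^sup>1\<close> limit of a sum of
  squares (\<open>tendsto_integral_sum_squares_perturbed\<close>).  Hence the jackknife estimator tends to \<open>s\<close> in
  \<open>L\<^sup>1\<close>, which contains both convergence in probability and convergence of the expectations.

  The same perturbation lemma with one summand, applied to \<open>N\<^bsup>-1/2\<^esup> \<Sum>\<^sub>j Y\<^sub>j\<close> and \<open>N\<^bsup>1/2\<^esup> R\<^sub>N\<close>, shows that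
  \<open>N Var(T\<^sub>N)\<close> tends to \<open>s\<close> (\<open>scaled_variance_tendsto\<close>).  So \<open>s\<close> is the asymptotic variance, and the
  two claims on the estimator of \<open>Var(T\<^sub>N)\<close> are those on \<open>\<sigma>\<^sup>2\<close> with the denominator \<open>s\<close> replaced
  by a sequence tending to \<open>s\<close> (\<open>ratio_consistent\<close>).
\<close>

section \<open>Perturbing a sum of squares in \<open>L\<^sup>1\<close>\<close>

lemma Cauchy_Schwarz_integral:
  fixes f g :: "'a \<Rightarrow> real"
  assumes [measurable]: "f \<in> borel_measurable M" "g \<in> borel_measurable M"
    and f: "integrable M (\<lambda>x. (f x)\<^sup>2)" and g: "integrable M (\<lambda>x. (g x)\<^sup>2)"
  shows "integrable M (\<lambda>x. f x * g x)"
    and "(\<integral>x. \<bar>f x * g x\<bar> \<partial>M) \<le> sqrt ((\<integral>x. (f x)\<^sup>2 \<partial>M) * (\<integral>x. (g x)\<^sup>2 \<partial>M))"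
proof -
  show int: "integrable M (\<lambda>x. f x * g x)"
  proof (rule Bochner_Integration.integrable_bound)
    show "integrable M (\<lambda>x. (f x)\<^sup>2 + (g x)\<^sup>2)"
      using f g by simp
    have "\<bar>f x * g x\<bar> \<le> (f x)\<^sup>2 + (g x)\<^sup>2" for x
    proof -
      have "2 * (\<bar>f x\<bar> * \<bar>g x\<bar>) \<le> \<bar>f x\<bar>\<^sup>2 + \<bar>g x\<bar>\<^sup>2"
        using sum_squares_bound[of "\<bar>f x\<bar>" "\<bar>g x\<bar>"] by (simp add: mult.assoc)
      moreover have "0 \<le> \<bar>f x\<bar> * \<bar>g x\<bar>"
        by simp
      ultimately show ?thesis
        by (simp only: abs_mult power2_abs)
    qed
    then show "AE x in M. norm (f x * g x) \<le> norm ((f x)\<^sup>2 + (g x)\<^sup>2)"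
      by (intro AE_I2) (simp add: abs_of_nonneg)
  qed measurable
  have "(\<integral>\<^sup>+x. ennreal \<bar>f x\<bar> * ennreal \<bar>g x\<bar> \<partial>M)\<^sup>2
      \<le> (\<integral>\<^sup>+x. ennreal \<bar>f x\<bar> ^ 2 \<partial>M) * (\<integral>\<^sup>+x. ennreal \<bar>g x\<bar> ^ 2 \<partial>M)"
    by (rule Cauchy_Schwarz_nn_integral) measurable
  also have "(\<integral>\<^sup>+x. ennreal \<bar>f x\<bar> ^ 2 \<partial>M) = ennreal (\<integral>x. (f x)\<^sup>2 \<partial>M)"
    using f by (simp add: ennreal_power nn_integral_eq_integral)
  also have "(\<integral>\<^sup>+x. ennreal \<bar>g x\<bar> ^ 2 \<partial>M) = ennreal (\<integral>x. (g x)\<^sup>2 \<partial>M)"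
    using g by (simp add: ennreal_power nn_integral_eq_integral)
  also have "(\<integral>\<^sup>+x. ennreal \<bar>f x\<bar> * ennreal \<bar>g x\<bar> \<partial>M) = ennreal (\<integral>x. \<bar>f x * g x\<bar> \<partial>M)"
    using integrable_abs[OF int]
    by (simp add: ennreal_mult'[symmetric] abs_mult[symmetric] nn_integral_eq_integral)
  finally have "(\<integral>x. \<bar>f x * g x\<bar> \<partial>M)\<^sup>2 \<le> (\<integral>x. (f x)\<^sup>2 \<partial>M) * (\<integral>x. (g x)\<^sup>2 \<partial>M)"
    by (simp add: ennreal_power ennreal_mult'[symmetric])
  then show "(\<integral>x. \<bar>f x * g x\<bar> \<partial>M) \<le> sqrt ((\<integral>x. (f x)\<^sup>2 \<partial>M) * (\<integral>x. (g x)\<^sup>2 \<partial>M))"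
    by (rule real_le_rsqrt)
qed

lemma square_integrable_sum:
  fixes f :: "'i \<Rightarrow> 'a \<Rightarrow> real"
  assumes "finite I"
    and meas: "\<And>i. i \<in> I \<Longrightarrow> f i \<in> borel_measurable M"
    and sq: "\<And>i. i \<in> I \<Longrightarrow> integrable M (\<lambda>x. (f i x)\<^sup>2)"
  shows "integrable M (\<lambda>x. (\<Sum>i\<in>I. f i x)\<^sup>2)"
  unfolding power2_eq_square sum_product
  by (intro Bochner_Integration.integrable_sum Cauchy_Schwarz_integral(1) meas sq)

lemma square_integrable_add:
  fixes f g :: "'a \<Rightarrow> real"
  assumes "f \<in> borel_measurable M" "g \<in> borel_measurable M"
    and "integrable M (\<lambda>x. (f x)\<^sup>2)" "integrable M (\<lambda>x. (g x)\<^sup>2)"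
  shows "integrable M (\<lambda>x. (f x + g x)\<^sup>2)"
  using assms Cauchy_Schwarz_integral(1)[OF assms]
  by (simp add: power2_sum mult.assoc)

text \<open>
  The absolute value around the product of roots matches the left-hand side of
  \<open>Cauchy_Schwarz_integral\<close>, which is applied to the expectation of this bound.
\<close>
lemma abs_sum_squares_perturbed:
  fixes u v :: "'i \<Rightarrow> real"
  shows "\<bar>(\<Sum>i\<in>I. (u i + v i)\<^sup>2) - (\<Sum>i\<in>I. (u i)\<^sup>2)\<bar>
    \<le> 2 * \<bar>sqrt (\<Sum>i\<in>I. (u i)\<^sup>2) * sqrt (\<Sum>i\<in>I. (v i)\<^sup>2)\<bar> + (\<Sum>i\<in>I. (v i)\<^sup>2)"
proof -
  have "(\<Sum>i\<in>I. (u i + v i)\<^sup>2) - (\<Sum>i\<in>I. (u i)\<^sup>2) = 2 * (\<Sum>i\<in>I. u i * v i) + (\<Sum>i\<in>I. (v i)\<^sup>2)"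
    by (simp add: power2_sum sum.distrib sum_distrib_left mult.assoc)
  moreover have "\<bar>\<Sum>i\<in>I. u i * v i\<bar> \<le> \<bar>sqrt (\<Sum>i\<in>I. (u i)\<^sup>2) * sqrt (\<Sum>i\<in>I. (v i)\<^sup>2)\<bar>"
    using real_sqrt_le_mono[OF Cauchy_Schwarz_ineq_sum[of u v I]]
    by (simp add: real_sqrt_mult)
  moreover have "0 \<le> (\<Sum>i\<in>I. (v i)\<^sup>2)"
    by (simp add: sum_nonneg)
  ultimately show ?thesis
    by linarith
qed

text \<open>
  Cauchy-Schwarz is used twice: over the index set for fixed \<open>x\<close>, and then over the measure space
  for the Euclidean lengths of \<open>u\<close> and \<open>v\<close>.
\<close>
lemma integral_sum_squares_perturbed:
  fixes u v :: "'i \<Rightarrow> 'a \<Rightarrow> real"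
  assumes "finite I"
    and u [measurable]: "\<And>i. i \<in> I \<Longrightarrow> u i \<in> borel_measurable M"
    and v [measurable]: "\<And>i. i \<in> I \<Longrightarrow> v i \<in> borel_measurable M"
    and u2: "\<And>i. i \<in> I \<Longrightarrow> integrable M (\<lambda>x. (u i x)\<^sup>2)"
    and v2: "\<And>i. i \<in> I \<Longrightarrow> integrable M (\<lambda>x. (v i x)\<^sup>2)"
  shows "(\<integral>x. \<bar>(\<Sum>i\<in>I. (u i x + v i x)\<^sup>2) - (\<Sum>i\<in>I. (u i x)\<^sup>2)\<bar> \<partial>M)
    \<le> 2 * sqrt ((\<integral>x. (\<Sum>i\<in>I. (u i x)\<^sup>2) \<partial>M) * (\<integral>x. (\<Sum>i\<in>I. (v i x)\<^sup>2) \<partial>M))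
      + (\<integral>x. (\<Sum>i\<in>I. (v i x)\<^sup>2) \<partial>M)"
proof -
  let ?a = "\<lambda>x. sqrt (\<Sum>i\<in>I. (u i x)\<^sup>2)" and ?b = "\<lambda>x. sqrt (\<Sum>i\<in>I. (v i x)\<^sup>2)"
  have a2: "(?a x)\<^sup>2 = (\<Sum>i\<in>I. (u i x)\<^sup>2)" and b2: "(?b x)\<^sup>2 = (\<Sum>i\<in>I. (v i x)\<^sup>2)" for x
    by (simp_all add: sum_nonneg)
  have [measurable]: "?a \<in> borel_measurable M" "?b \<in> borel_measurable M"
    by measurable
  have int: "integrable M (\<lambda>x. (?a x)\<^sup>2)" "integrable M (\<lambda>x. (?b x)\<^sup>2)"
    unfolding a2 b2 using u2 v2 by auto
  note CS = Cauchy_Schwarz_integral[of ?a M ?b, OF _ _ int, unfolded a2 b2]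
  have "(\<integral>x. \<bar>(\<Sum>i\<in>I. (u i x + v i x)\<^sup>2) - (\<Sum>i\<in>I. (u i x)\<^sup>2)\<bar> \<partial>M)
      \<le> (\<integral>x. 2 * \<bar>?a x * ?b x\<bar> + (\<Sum>i\<in>I. (v i x)\<^sup>2) \<partial>M)"
  proof (rule integral_mono)
    show "integrable M (\<lambda>x. \<bar>(\<Sum>i\<in>I. (u i x + v i x)\<^sup>2) - (\<Sum>i\<in>I. (u i x)\<^sup>2)\<bar>)"
      using u v u2 v2 by (intro integrable_abs Bochner_Integration.integrable_diff
          Bochner_Integration.integrable_sum square_integrable_add) auto
    show "integrable M (\<lambda>x. 2 * \<bar>?a x * ?b x\<bar> + (\<Sum>i\<in>I. (v i x)\<^sup>2))"
      using CS(1) v2 by (intro Bochner_Integration.integrable_add integrable_mult_right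
          integrable_abs Bochner_Integration.integrable_sum) auto
  qed (rule abs_sum_squares_perturbed)
  also have "\<dots> = 2 * (\<integral>x. \<bar>?a x * ?b x\<bar> \<partial>M) + (\<integral>x. (\<Sum>i\<in>I. (v i x)\<^sup>2) \<partial>M)"
    using CS(1) v2 by (subst Bochner_Integration.integral_add) auto
  finally show ?thesis
    using CS(2) by simp
qed

text \<open>
  The index sets may grow with \<open>n\<close>: only the expected squared lengths of \<open>u\<close> and \<open>v\<close> enter.  The
  jackknife uses \<open>N\<close> summands, the asymptotic variance of the statistic a single one.
\<close>
lemma tendsto_integral_sum_squares_perturbed:
  fixes u v :: "nat \<Rightarrow> 'i \<Rightarrow> 'a \<Rightarrow> real" and I :: "nat \<Rightarrow> 'i set"
  assumes I: "\<And>n. finite (I n)"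
    and reg: "\<forall>\<^sub>F n in sequentially. \<forall>i\<in>I n.
        u n i \<in> borel_measurable M \<and> v n i \<in> borel_measurable M \<and>
        integrable M (\<lambda>x. (u n i x)\<^sup>2) \<and> integrable M (\<lambda>x. (v n i x)\<^sup>2)"
    and ulim: "(\<lambda>n. \<integral>x. (\<Sum>i\<in>I n. (u n i x)\<^sup>2) \<partial>M) \<longlonglongrightarrow> s"
    and vlim: "(\<lambda>n. \<integral>x. (\<Sum>i\<in>I n. (v n i x)\<^sup>2) \<partial>M) \<longlonglongrightarrow> 0"
  shows "(\<lambda>n. \<integral>x. \<bar>(\<Sum>i\<in>I n. (u n i x + v n i x)\<^sup>2) - (\<Sum>i\<in>I n. (u n i x)\<^sup>2)\<bar> \<partial>M)
    \<longlonglongrightarrow> 0"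
proof (rule tendsto_sandwich[OF _ _ tendsto_const])
  show "(\<lambda>n. 2 * sqrt ((\<integral>x. (\<Sum>i\<in>I n. (u n i x)\<^sup>2) \<partial>M) * (\<integral>x. (\<Sum>i\<in>I n. (v n i x)\<^sup>2) \<partial>M))
      + (\<integral>x. (\<Sum>i\<in>I n. (v n i x)\<^sup>2) \<partial>M)) \<longlonglongrightarrow> 0"
    using tendsto_add[OF tendsto_mult[OF tendsto_const[of 2] tendsto_real_sqrt[OF tendsto_mult[OF ulim vlim]]] vlim]
    by simp
  show "\<forall>\<^sub>F n in sequentially.
      (\<integral>x. \<bar>(\<Sum>i\<in>I n. (u n i x + v n i x)\<^sup>2) - (\<Sum>i\<in>I n. (u n i x)\<^sup>2)\<bar> \<partial>M)
      \<le> 2 * sqrt ((\<integral>x. (\<Sum>i\<in>I n. (u n i x)\<^sup>2) \<partial>M) * (\<integral>x. (\<Sum>i\<in>I n. (v n i x)\<^sup>2) \<partial>M))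
      + (\<integral>x. (\<Sum>i\<in>I n. (v n i x)\<^sup>2) \<partial>M)"
    using reg by eventually_elim (rule integral_sum_squares_perturbed, auto simp: I)
qed simp

lemma sum_sq_deviation:
  fixes a :: "'i \<Rightarrow> real"
  assumes "finite I"
  shows "(\<Sum>i\<in>I. (a i - (\<Sum>j\<in>I. a j) / card I)\<^sup>2) \<le> (\<Sum>i\<in>I. (a i)\<^sup>2)"
    and "(\<Sum>i\<in>I. (a i - (\<Sum>j\<in>I. a j) / card I)\<^sup>2) = (\<Sum>i\<in>I. (a i)\<^sup>2) - (\<Sum>i\<in>I. a i)\<^sup>2 / card I"
proof -
  show eq: "(\<Sum>i\<in>I. (a i - (\<Sum>j\<in>I. a j) / card I)\<^sup>2) = (\<Sum>i\<in>I. (a i)\<^sup>2) - (\<Sum>i\<in>I. a i)\<^sup>2 / card I"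
  proof (cases "I = {}")
    case False
    then have "real (card I) > 0" using assms by (simp add: card_gt_0_iff)
    have dev: "(\<Sum>i\<in>I. (a i - m)\<^sup>2) = (\<Sum>i\<in>I. (a i)\<^sup>2) + card I * m\<^sup>2 - 2 * m * (\<Sum>i\<in>I. a i)" for m :: real
      by (simp add: power2_diff sum.distrib sum_subtractf sum_distrib_left sum_distrib_right mult_ac)
    show ?thesis
      unfolding dev using \<open>real (card I) > 0\<close> by (simp add: power2_eq_square field_simps)
  qed simp
  show "(\<Sum>i\<in>I. (a i - (\<Sum>j\<in>I. a j) / card I)\<^sup>2) \<le> (\<Sum>i\<in>I. (a i)\<^sup>2)"
    unfolding eq by simp
qed

section \<open>Independent identically distributed variables\<close>

lemma identically_distributed_integral:
  fixes f :: "'b \<Rightarrow> real"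
  assumes "distr M D Y = distr M D Z" "Y \<in> M \<rightarrow>\<^sub>M D" "Z \<in> M \<rightarrow>\<^sub>M D" "f \<in> borel_measurable D"
  shows "(\<integral>\<omega>. f (Y \<omega>) \<partial>M) = (\<integral>\<omega>. f (Z \<omega>) \<partial>M)"
    and "integrable M (\<lambda>\<omega>. f (Y \<omega>)) \<longleftrightarrow> integrable M (\<lambda>\<omega>. f (Z \<omega>))"
  using assms integral_distr[of Y M D f] integral_distr[of Z M D f]
    integrable_distr_eq[of Y M D f] integrable_distr_eq[of Z M D f] by simp_all

context prob_space
begin

text \<open>The mixed moments vanish, since they factor into vanishing means.\<close>
lemma second_moment_sum_indep:
  fixes Y :: "'i \<Rightarrow> 'a \<Rightarrow> real"
  assumes "finite L" and ind: "indep_vars (\<lambda>_. borel) Y L"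
    and sq: "\<And>i. i \<in> L \<Longrightarrow> integrable M (\<lambda>\<omega>. (Y i \<omega>)\<^sup>2)"
    and mean: "\<And>i. i \<in> L \<Longrightarrow> expectation (Y i) = 0"
  shows "expectation (\<lambda>\<omega>. (\<Sum>i\<in>L. Y i \<omega>)\<^sup>2) = (\<Sum>i\<in>L. expectation (\<lambda>\<omega>. (Y i \<omega>)\<^sup>2))"
proof -
  have meas: "Y i \<in> borel_measurable M" if "i \<in> L" for i
    using ind that by (auto simp: indep_vars_def)
  have int: "integrable M (\<lambda>\<omega>. Y i \<omega> * Y j \<omega>)" if "i \<in> L" "j \<in> L" for i j
    using that by (intro Cauchy_Schwarz_integral(1) meas sq)
  have cross: "expectation (\<lambda>\<omega>. Y i \<omega> * Y j \<omega>) = 0" if "i \<in> L" "j \<in> L" "i \<noteq> j" for i j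
  proof -
    have "expectation (\<lambda>\<omega>. \<Prod>k\<in>{i, j}. Y k \<omega>) = (\<Prod>k\<in>{i, j}. expectation (Y k))"
      using that by (intro indep_vars_lebesgue_integral indep_vars_subset[OF ind])
        (auto intro!: square_integrable_imp_integrable meas sq)
    then show ?thesis
      using that mean by simp
  qed
  have "expectation (\<lambda>\<omega>. (\<Sum>i\<in>L. Y i \<omega>)\<^sup>2) = (\<Sum>i\<in>L. \<Sum>j\<in>L. expectation (\<lambda>\<omega>. Y i \<omega> * Y j \<omega>))"
    using int by (simp add: power2_eq_square sum_product)
  also have "\<dots> = (\<Sum>i\<in>L. \<Sum>j\<in>L. if j = i then expectation (\<lambda>\<omega>. (Y i \<omega>)\<^sup>2) else 0)"
    using cross by (intro sum.cong refl) (auto simp: power2_eq_square)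
  also have "\<dots> = (\<Sum>i\<in>L. expectation (\<lambda>\<omega>. (Y i \<omega>)\<^sup>2))"
    using \<open>finite L\<close> by simp
  finally show ?thesis .
qed

text \<open>
  Exchangeability: the joint distribution is a product of equal factors, so reindexing the
  coordinates leaves it unchanged.
\<close>
lemma iid_permuted_distr:
  assumes ind: "indep_vars (\<lambda>_. D) Z L"
    and L: "L \<noteq> {}"
    and same: "\<And>i j. i \<in> L \<Longrightarrow> j \<in> L \<Longrightarrow> distr M D (Z i) = distr M D (Z j)"
    and p: "p permutes L"
  shows "distr M (\<Pi>\<^sub>M i\<in>L. D) (\<lambda>\<omega>. \<lambda>i\<in>L. Z (p i) \<omega>) = distr M (\<Pi>\<^sub>M i\<in>L. D) (\<lambda>\<omega>. \<lambda>i\<in>L. Z i \<omega>)"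
proof -
  have Z [measurable]: "Z i \<in> M \<rightarrow>\<^sub>M D" if "i \<in> L" for i
    using ind that by (auto simp: indep_vars_def)
  have pL: "p i \<in> L" if "i \<in> L" for i
    using p that by (simp add: permutes_in_image)
  have joint: "distr M (\<Pi>\<^sub>M i\<in>L. D) (\<lambda>\<omega>. \<lambda>i\<in>L. Z i \<omega>) = (\<Pi>\<^sub>M i\<in>L. distr M D (Z i))"
    using ind L Z by (subst (asm) indep_vars_iff_distr_eq_PiM') auto
  have perm: "(\<lambda>z. \<lambda>i\<in>L. z (p i)) \<in> (\<Pi>\<^sub>M i\<in>L. D) \<rightarrow>\<^sub>M (\<Pi>\<^sub>M i\<in>L. D)"
    using pL by (intro measurable_restrict measurable_component_singleton)
  have sets: "sets (\<Pi>\<^sub>M i\<in>L. distr M D (Z (f i))) = sets (\<Pi>\<^sub>M i\<in>L. D)" for f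
    by (intro sets_PiM_cong) auto
  have "distr M (\<Pi>\<^sub>M i\<in>L. D) (\<lambda>\<omega>. \<lambda>i\<in>L. Z (p i) \<omega>)
      = distr (distr M (\<Pi>\<^sub>M i\<in>L. D) (\<lambda>\<omega>. \<lambda>i\<in>L. Z i \<omega>)) (\<Pi>\<^sub>M i\<in>L. D) (\<lambda>z. \<lambda>i\<in>L. z (p i))"
    using pL by (subst distr_distr[OF perm]) (auto intro!: distr_cong measurable_restrict Z simp: fun_eq_iff)
  also have "\<dots> = distr (\<Pi>\<^sub>M i\<in>L. distr M D (Z i)) (\<Pi>\<^sub>M i\<in>L. distr M D (Z (p i))) (\<lambda>z. \<lambda>i\<in>L. z (p i))"
    unfolding joint by (intro distr_cong refl sets[of p, symmetric])
  also have "\<dots> = (\<Pi>\<^sub>M i\<in>L. distr M D (Z (p i)))"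
    using p pL by (intro distr_PiM_reindex prob_space_distr Z) (auto intro: permutes_inj_on)
  also have "\<dots> = (\<Pi>\<^sub>M i\<in>L. distr M D (Z i))"
    by (intro PiM_cong refl same pL)
  finally show ?thesis
    by (simp add: joint)
qed


lemma expectation_abs_le_sqrt:
  assumes "f \<in> borel_measurable M" "integrable M (\<lambda>\<omega>. (f \<omega>)\<^sup>2)"
  shows "expectation (\<lambda>\<omega>. \<bar>f \<omega> :: real\<bar>) \<le> sqrt (expectation (\<lambda>\<omega>. (f \<omega>)\<^sup>2))"
  using Cauchy_Schwarz_integral(2)[of f M "\<lambda>_. 1"] assms by (simp add: prob_space)

text \<open>
  Up to the factor \<open>1 / (N - 1)\<close>, the error is the centred independent sum of the \<open>Y\<^sub>i\<^sup>2 - s\<close>, whose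
  \<open>L\<^sup>1\<close> norm is \<open>O(sqrt N)\<close> by the fourth moments, minus \<open>(\<Sum>\<^sub>i Y\<^sub>i)\<^sup>2 / N\<close>, whose expectation is \<open>s\<close>,
  plus \<open>s\<close> itself.
\<close>
lemma sample_variance_tendsto_L1:
  fixes Y :: "nat \<Rightarrow> 'a \<Rightarrow> real"
  assumes ind: "indep_vars (\<lambda>_. borel) Y {1..}"
    and same: "\<And>i. i \<ge> 1 \<Longrightarrow> distr M borel (Y i) = distr M borel (Y 1)"
    and moment4: "integrable M (\<lambda>\<omega>. Y 1 \<omega> ^ 4)"
    and mean: "expectation (Y 1) = 0"
  defines "s \<equiv> expectation (\<lambda>\<omega>. (Y 1 \<omega>)\<^sup>2)"
  shows "(\<lambda>N. expectation (\<lambda>\<omega>.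
      \<bar>1 / (real N - 1) * (\<Sum>i=1..N. (Y i \<omega> - (\<Sum>j=1..N. Y j \<omega>) / real N)\<^sup>2) - s\<bar>)) \<longlonglongrightarrow> 0"
proof -
  have Y [measurable]: "Y i \<in> borel_measurable M" if "i \<ge> 1" for i
    using ind that by (auto simp: indep_vars_def)
  note transfer = identically_distributed_integral[OF same Y Y[OF order_refl]]
  \<comment> \<open>The fourth moments of \<open>Y\<close> are second moments of these centred squares.\<close>
  let ?W = "\<lambda>i \<omega>. (Y i \<omega>)\<^sup>2 - s"
  define w where "w = expectation (\<lambda>\<omega>. (?W 1 \<omega>)\<^sup>2)"
  have "w \<ge> 0" "s \<ge> 0"
    by (simp_all add: w_def s_def)
  have int_sq1: "integrable M (\<lambda>\<omega>. (Y 1 \<omega>)\<^sup>2)"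
    using moment4 by (intro square_integrable_imp_integrable[of "\<lambda>\<omega>. (Y 1 \<omega>)\<^sup>2"]) simp_all
  have sq: "integrable M (\<lambda>\<omega>. (Y i \<omega>)\<^sup>2)" if "i \<ge> 1" for i
    using transfer(2)[of i "\<lambda>x. x\<^sup>2"] that int_sq1 by simp
  have "integrable M (\<lambda>\<omega>. (?W 1 \<omega>)\<^sup>2)"
    using int_sq1 moment4 by (simp add: power2_diff)
  then have sqW: "integrable M (\<lambda>\<omega>. (?W i \<omega>)\<^sup>2)" if "i \<ge> 1" for i
    using transfer(2)[of i "\<lambda>x. (x\<^sup>2 - s)\<^sup>2"] that by simp
  have EY: "expectation (Y i) = 0" if "i \<ge> 1" for i
    using mean transfer(1)[of i "\<lambda>x. x"] that by simp
  have EW: "expectation (?W i) = 0" if "i \<ge> 1" for i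
    using transfer(1)[of i "\<lambda>x. x\<^sup>2"] sq that by (simp add: s_def prob_space)
  have sumY: "expectation (\<lambda>\<omega>. (\<Sum>i=1..N. Y i \<omega>)\<^sup>2) = real N * s" for N
  proof -
    have "expectation (\<lambda>\<omega>. (\<Sum>i=1..N. Y i \<omega>)\<^sup>2) = (\<Sum>i=1..N. expectation (\<lambda>\<omega>. (Y i \<omega>)\<^sup>2))"
      using EY sq by (intro second_moment_sum_indep indep_vars_subset[OF ind]) auto
    also have "\<dots> = (\<Sum>i=1..N. s)"
      using transfer(1)[of _ "\<lambda>x. x\<^sup>2", folded s_def] by (intro sum.cong refl) simp
    finally show ?thesis by simp
  qed
  have sumW: "expectation (\<lambda>\<omega>. (\<Sum>i=1..N. ?W i \<omega>)\<^sup>2) = real N * w" for N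
  proof -
    have "indep_vars (\<lambda>_. borel) ?W {1..N}"
      using indep_vars_compose2[OF indep_vars_subset[OF ind, of "{1..N}"], of "\<lambda>_ x. x\<^sup>2 - s" "\<lambda>_. borel"]
      by auto
    then have "expectation (\<lambda>\<omega>. (\<Sum>i=1..N. ?W i \<omega>)\<^sup>2) = (\<Sum>i=1..N. expectation (\<lambda>\<omega>. (?W i \<omega>)\<^sup>2))"
      using EW sqW by (intro second_moment_sum_indep) auto
    also have "\<dots> = (\<Sum>i=1..N. w)"
      using transfer(1)[of _ "\<lambda>x. (x\<^sup>2 - s)\<^sup>2", folded w_def] by (intro sum.cong refl) simp
    finally show ?thesis by simp
  qed
  have bound: "expectation (\<lambda>\<omega>.
      \<bar>1 / (real N - 1) * (\<Sum>i=1..N. (Y i \<omega> - (\<Sum>j=1..N. Y j \<omega>) / real N)\<^sup>2) - s\<bar>)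
      \<le> 1 / (real N - 1) * (sqrt (real N) * sqrt w + 2 * s)" (is "expectation ?L \<le> _")
    if "N \<ge> 2" for N
  proof -
    have N: "real N - 1 > 0" "real N > 0" using that by auto
    let ?A = "\<lambda>\<omega>. \<Sum>i=1..N. ?W i \<omega>" and ?B = "\<lambda>\<omega>. \<Sum>i=1..N. Y i \<omega>"
    have intW: "integrable M (?W i)" if "i \<ge> 1" for i
      using sq[OF that] by simp
    have intA: "integrable M ?A"
      using intW by (intro Bochner_Integration.integrable_sum) auto
    have intA2: "integrable M (\<lambda>\<omega>. (?A \<omega>)\<^sup>2)"
      using sqW by (intro square_integrable_sum) auto
    have intB2: "integrable M (\<lambda>\<omega>. (?B \<omega>)\<^sup>2)"
      using sq by (intro square_integrable_sum) auto
    let ?R = "\<lambda>\<omega>. 1 / (real N - 1) * (\<bar>?A \<omega>\<bar> + (?B \<omega>)\<^sup>2 / real N + s)"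
    have le: "?L \<omega> \<le> ?R \<omega>" for \<omega>
    proof -
      have "(\<Sum>i=1..N. (Y i \<omega> - ?B \<omega> / real N)\<^sup>2) = (\<Sum>i=1..N. (Y i \<omega>)\<^sup>2) - (?B \<omega>)\<^sup>2 / real N"
        using sum_sq_deviation(2)[of "{1..N}" "\<lambda>i. Y i \<omega>"] by simp
      also have "\<dots> = ?A \<omega> - (?B \<omega>)\<^sup>2 / real N + real N * s"
        by (simp add: sum_subtractf)
      finally have dev: "(\<Sum>i=1..N. (Y i \<omega> - ?B \<omega> / real N)\<^sup>2)
          = ?A \<omega> - (?B \<omega>)\<^sup>2 / real N + real N * s" .
      have "1 / (real N - 1) * (\<Sum>i=1..N. (Y i \<omega> - ?B \<omega> / real N)\<^sup>2) - s
          = 1 / (real N - 1) * (?A \<omega> - (?B \<omega>)\<^sup>2 / real N + s)"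
        unfolding dev using N by (simp add: field_simps)
      then have "?L \<omega> = 1 / (real N - 1) * \<bar>?A \<omega> - (?B \<omega>)\<^sup>2 / real N + s\<bar>"
        using N by (simp add: abs_mult)
      also have "\<dots> \<le> ?R \<omega>"
      proof (rule mult_left_mono)
        have "(?B \<omega>)\<^sup>2 / real N \<ge> 0" by simp
        then show "\<bar>?A \<omega> - (?B \<omega>)\<^sup>2 / real N + s\<bar> \<le> \<bar>?A \<omega>\<bar> + (?B \<omega>)\<^sup>2 / real N + s"
          using \<open>s \<ge> 0\<close> by linarith
      qed (use N in simp)
      finally show ?thesis .
    qed
    have intR: "integrable M ?R"
      using intA intB2 by (intro integrable_mult_right Bochner_Integration.integrable_add) auto
    have "expectation ?L \<le> expectation ?R"
    proof (rule integral_mono)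
      show "integrable M ?L"
      proof (rule Bochner_Integration.integrable_bound[OF intR])
        have "norm (?L \<omega>) \<le> norm (?R \<omega>)" for \<omega>
          using order_trans[OF le[of \<omega>] abs_ge_self] by (simp only: real_norm_def abs_idempotent)
        then show "AE \<omega> in M. norm (?L \<omega>) \<le> norm (?R \<omega>)" by simp
      qed measurable
    qed (use intR le in auto)
    also have "expectation ?R = 1 / (real N - 1) * (expectation (\<lambda>\<omega>. \<bar>?A \<omega>\<bar>) + 2 * s)"
      using intA intB2 sumY[of N] N by (simp add: prob_space)
    also have "\<dots> \<le> 1 / (real N - 1) * (sqrt (real N) * sqrt w + 2 * s)"
      using expectation_abs_le_sqrt[of ?A] intA intA2 sumW[of N] N
      by (intro mult_left_mono add_right_mono) (auto simp: real_sqrt_mult)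
    finally show ?thesis .
  qed
  show ?thesis
  proof (rule tendsto_sandwich[OF _ _ tendsto_const])
    show "(\<lambda>N. 1 / (real N - 1) * (sqrt (real N) * sqrt w + 2 * s)) \<longlonglongrightarrow> 0"
      by real_asymp
    show "\<forall>\<^sub>F N in sequentially. expectation (\<lambda>\<omega>.
      \<bar>1 / (real N - 1) * (\<Sum>i=1..N. (Y i \<omega> - (\<Sum>j=1..N. Y j \<omega>) / real N)\<^sup>2) - s\<bar>)
      \<le> 1 / (real N - 1) * (sqrt (real N) * sqrt w + 2 * s)"
      using eventually_ge_at_top[of 2] by eventually_elim (rule bound)
  qed simp
qed

section \<open>Consequences of \<open>L\<^sup>1\<close> convergence\<close>

lemma expectation_tendsto_of_L1:
  assumes int: "\<forall>\<^sub>F N in sequentially. integrable M (Y N)"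
    and L1: "(\<lambda>N. expectation (\<lambda>\<omega>. \<bar>Y N \<omega> - c\<bar>)) \<longlonglongrightarrow> 0"
  shows "(\<lambda>N. expectation (Y N)) \<longlonglongrightarrow> (c :: real)"
proof -
  have "(\<lambda>N. expectation (Y N) - c) \<longlonglongrightarrow> 0"
  proof (rule tendsto_rabs_zero_cancel, rule tendsto_sandwich[OF _ _ tendsto_const L1])
    show "\<forall>\<^sub>F N in sequentially. \<bar>expectation (Y N) - c\<bar> \<le> expectation (\<lambda>\<omega>. \<bar>Y N \<omega> - c\<bar>)"
      using int
    proof eventually_elim
      case (elim N)
      then have "expectation (Y N) - c = expectation (\<lambda>\<omega>. Y N \<omega> - c)"
        by (simp add: prob_space)
      then show ?case
        by (simp add: integral_abs_bound)
    qed
  qed simp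
  then show ?thesis
    by (rule LIM_zero_cancel)
qed

text \<open>
  For convergence in probability the deviation of the ratio is bounded by the deviations of
  numerator and denominator from \<open>c\<close>, and Markov's inequality is applied to their sum.
\<close>
lemma ratio_consistent:
  assumes int: "\<forall>\<^sub>F N in sequentially. integrable M (Y N)"
    and L1: "(\<lambda>N. expectation (\<lambda>\<omega>. \<bar>Y N \<omega> - c\<bar>)) \<longlonglongrightarrow> 0"
    and v: "v \<longlonglongrightarrow> c" and "c > 0"
  shows "tendsto_in_prob M (\<lambda>N \<omega>. Y N \<omega> / v N) 1"
    and "(\<lambda>N. expectation (Y N) / v N) \<longlonglongrightarrow> 1"
proof -
  have vpos: "\<forall>\<^sub>F N in sequentially. v N > 0"
    using order_tendstoD(1)[OF v \<open>c > 0\<close>] .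
  note expectation_tendsto_of_L1[OF int L1]
  from tendsto_divide[OF this v] \<open>c > 0\<close> show "(\<lambda>N. expectation (Y N) / v N) \<longlonglongrightarrow> 1"
    by simp
  show "tendsto_in_prob M (\<lambda>N \<omega>. Y N \<omega> / v N) 1"
    unfolding tendsto_in_prob_def
  proof (intro allI impI)
    fix \<epsilon> :: real assume "\<epsilon> > 0"
    show "(\<lambda>N. prob {\<omega> \<in> space M. \<bar>Y N \<omega> / v N - 1\<bar> > \<epsilon>}) \<longlonglongrightarrow> 0"
    proof (rule tendsto_sandwich[OF _ _ tendsto_const])
      show "(\<lambda>N. (expectation (\<lambda>\<omega>. \<bar>Y N \<omega> - c\<bar>) + \<bar>c - v N\<bar>) / (\<epsilon> * v N)) \<longlonglongrightarrow> 0"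
        using tendsto_divide[OF tendsto_add[OF L1 tendsto_rabs[OF tendsto_diff[OF tendsto_const[of c] v]]]
            tendsto_mult[OF tendsto_const[of \<epsilon>] v]] \<open>c > 0\<close> \<open>\<epsilon> > 0\<close>
        by simp
      show "\<forall>\<^sub>F N in sequentially. prob {\<omega> \<in> space M. \<bar>Y N \<omega> / v N - 1\<bar> > \<epsilon>}
          \<le> (expectation (\<lambda>\<omega>. \<bar>Y N \<omega> - c\<bar>) + \<bar>c - v N\<bar>) / (\<epsilon> * v N)"
        using int vpos
      proof eventually_elim
        case (elim N)
        note [measurable] = borel_measurable_integrable[OF elim(1)]
        have "prob {\<omega> \<in> space M. \<bar>Y N \<omega> / v N - 1\<bar> > \<epsilon>} \<le> prob {\<omega> \<in> space M. \<bar>Y N \<omega> - c\<bar> + \<bar>c - v N\<bar> \<ge> \<epsilon> * v N}"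
        proof (rule finite_measure_mono)
          show "{\<omega> \<in> space M. \<bar>Y N \<omega> / v N - 1\<bar> > \<epsilon>} \<subseteq> {\<omega> \<in> space M. \<bar>Y N \<omega> - c\<bar> + \<bar>c - v N\<bar> \<ge> \<epsilon> * v N}"
          proof safe
            fix \<omega> assume "\<bar>Y N \<omega> / v N - 1\<bar> > \<epsilon>"
            moreover have "\<bar>Y N \<omega> / v N - 1\<bar> = \<bar>Y N \<omega> - v N\<bar> / v N"
            proof -
              have "Y N \<omega> / v N - 1 = (Y N \<omega> - v N) / v N"
                using elim(2) by (simp add: diff_divide_distrib)
              then show ?thesis
                using elim(2) by simp
            qed
            ultimately have "\<bar>Y N \<omega> - v N\<bar> > \<epsilon> * v N"
              using elim(2) by (simp add: field_simps)
            then show "\<epsilon> * v N \<le> \<bar>Y N \<omega> - c\<bar> + \<bar>c - v N\<bar>"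
              by linarith
          qed
        qed measurable
        also have "\<dots> \<le> expectation (\<lambda>\<omega>. \<bar>Y N \<omega> - c\<bar> + \<bar>c - v N\<bar>) / (\<epsilon> * v N)"
          using elim \<open>\<epsilon> > 0\<close>
          by (intro integral_Markov_inequality_measure[where A="space M"]) auto
        also have "expectation (\<lambda>\<omega>. \<bar>Y N \<omega> - c\<bar> + \<bar>c - v N\<bar>) = expectation (\<lambda>\<omega>. \<bar>Y N \<omega> - c\<bar>) + \<bar>c - v N\<bar>"
          using elim by (simp add: prob_space)
        finally show ?case .
      qed
    qed simp
  qed
qed

section \<open>Asymptotic variance of a linear statistic with remainder\<close>

text \<open>
  With \<open>U\<^sub>N = N\<^bsup>-1/2\<^esup> \<Sum>\<^sub>j Y\<^sub>j\<close> and \<open>V\<^sub>N = N\<^bsup>1/2\<^esup> R\<^sub>N\<close> the variance is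
  \<open>E (U\<^sub>N + V\<^sub>N)\<^sup>2 - (E V\<^sub>N)\<^sup>2\<close>, because \<open>U\<^sub>N\<close> is centred.  The first term tends to
  \<open>E U\<^sub>N\<^sup>2 = E Y\<^sub>1\<^sup>2\<close> and the second is at most \<open>E V\<^sub>N\<^sup>2\<close>.
\<close>
lemma scaled_variance_tendsto:
  fixes Y S R :: "nat \<Rightarrow> 'a \<Rightarrow> real"
  assumes ind: "indep_vars (\<lambda>_. borel) Y {1..}"
    and same: "\<And>i. i \<ge> 1 \<Longrightarrow> distr M borel (Y i) = distr M borel (Y 1)"
    and moment2: "integrable M (\<lambda>\<omega>. (Y 1 \<omega>)\<^sup>2)"
    and mean: "expectation (Y 1) = 0"
    and R: "\<forall>\<^sub>F N in sequentially. R N \<in> borel_measurable M \<and> integrable M (\<lambda>\<omega>. (R N \<omega>)\<^sup>2)"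
    and R0: "(\<lambda>N. real N * expectation (\<lambda>\<omega>. (R N \<omega>)\<^sup>2)) \<longlonglongrightarrow> 0"
    and S: "\<And>N \<omega>. N \<ge> 1 \<Longrightarrow> \<omega> \<in> space M \<Longrightarrow> S N \<omega> = 1 / real N * (\<Sum>j=1..N. Y j \<omega>) + R N \<omega>"
  shows "(\<lambda>N. variance (\<lambda>\<omega>. sqrt (real N) * S N \<omega>)) \<longlonglongrightarrow> expectation (\<lambda>\<omega>. (Y 1 \<omega>)\<^sup>2)"
proof -
  have Y [measurable]: "Y i \<in> borel_measurable M" if "i \<ge> 1" for i
    using ind that by (auto simp: indep_vars_def)
  note transfer = identically_distributed_integral[OF same Y Y[OF order_refl]]
  define s where "s = expectation (\<lambda>\<omega>. (Y 1 \<omega>)\<^sup>2)"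
  have sq: "integrable M (\<lambda>\<omega>. (Y i \<omega>)\<^sup>2)" if "i \<ge> 1" for i
    using transfer(2)[of i "\<lambda>x. x\<^sup>2"] that moment2 by simp
  have EY: "expectation (Y i) = 0" if "i \<ge> 1" for i
    using mean transfer(1)[of i "\<lambda>x. x"] that by simp
  define U where "U = (\<lambda>N \<omega>. (\<Sum>j=1..N. Y j \<omega>) / sqrt (real N))"
  define V where "V = (\<lambda>N \<omega>. sqrt (real N) * R N \<omega>)"
  have measU: "U N \<in> borel_measurable M" for N
    unfolding U_def by measurable
  have intU2: "integrable M (\<lambda>\<omega>. (U N \<omega>)\<^sup>2)" for N
    unfolding U_def power_divide using sq by (intro integrable_divide square_integrable_sum) auto
  have intU: "integrable M (U N)" for N
    using measU intU2 by (rule square_integrable_imp_integrable)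
  have EU: "expectation (U N) = 0" for N
    unfolding U_def using EY square_integrable_imp_integrable[OF Y sq] by simp
  have EU2: "expectation (\<lambda>\<omega>. (U N \<omega>)\<^sup>2) = s" if "N \<ge> 1" for N
  proof -
    have "expectation (\<lambda>\<omega>. (\<Sum>i=1..N. Y i \<omega>)\<^sup>2) = (\<Sum>i=1..N. expectation (\<lambda>\<omega>. (Y i \<omega>)\<^sup>2))"
      using EY sq by (intro second_moment_sum_indep indep_vars_subset[OF ind]) auto
    also have "\<dots> = (\<Sum>i=1..N. s)"
      using transfer(1)[of _ "\<lambda>x. x\<^sup>2", folded s_def] by (intro sum.cong refl) simp
    finally show ?thesis
      using that by (simp add: U_def power_divide)
  qed
  have V: "\<forall>\<^sub>F N in sequentially. V N \<in> borel_measurable M \<and> integrable M (\<lambda>\<omega>. (V N \<omega>)\<^sup>2)"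
    using R by eventually_elim (auto simp: V_def power_mult_distrib)
  have V0: "(\<lambda>N. expectation (\<lambda>\<omega>. (V N \<omega>)\<^sup>2)) \<longlonglongrightarrow> 0"
    using R0 by (simp add: V_def power_mult_distrib)
  have L1: "(\<lambda>N. expectation (\<lambda>\<omega>. \<bar>(U N \<omega> + V N \<omega>)\<^sup>2 - (U N \<omega>)\<^sup>2\<bar>)) \<longlonglongrightarrow> 0"
  proof -
    have "(\<lambda>N. expectation (\<lambda>\<omega>. (U N \<omega>)\<^sup>2)) \<longlonglongrightarrow> s"
      using EU2 by (intro tendsto_eventually) (auto intro: eventually_sequentiallyI[of 1])
    then show ?thesis
      using tendsto_integral_sum_squares_perturbed[of "\<lambda>_. {()}" "\<lambda>N _. U N" M "\<lambda>N _. V N" s] V V0 measU intU2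
      by simp
  qed
  have bound: "\<forall>\<^sub>F N in sequentially. \<bar>variance (\<lambda>\<omega>. sqrt (real N) * S N \<omega>) - s\<bar>
      \<le> expectation (\<lambda>\<omega>. \<bar>(U N \<omega> + V N \<omega>)\<^sup>2 - (U N \<omega>)\<^sup>2\<bar>) + expectation (\<lambda>\<omega>. (V N \<omega>)\<^sup>2)"
    using V eventually_ge_at_top[of 1]
  proof eventually_elim
    case (elim N)
    have intV: "integrable M (V N)"
      using elim by (intro square_integrable_imp_integrable[of "V N"]) auto
    have intUV2: "integrable M (\<lambda>\<omega>. (U N \<omega> + V N \<omega>)\<^sup>2)"
      using elim measU intU2 by (intro square_integrable_add) auto
    have S_eq: "sqrt (real N) * S N \<omega> = U N \<omega> + V N \<omega>" if "\<omega> \<in> space M" for \<omega>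
    proof -
      have "sqrt (real N) * (1 / real N) = 1 / sqrt (real N)"
        using elim(2) by (simp add: field_simps)
      then show ?thesis
        unfolding S[OF elim(2) that] U_def V_def distrib_left mult.assoc[symmetric] by simp
    qed
    have "variance (\<lambda>\<omega>. sqrt (real N) * S N \<omega>) = variance (\<lambda>\<omega>. U N \<omega> + V N \<omega>)"
      using S_eq by (simp cong: Bochner_Integration.integral_cong)
    also have "\<dots> = expectation (\<lambda>\<omega>. (U N \<omega> + V N \<omega>)\<^sup>2) - (expectation (V N))\<^sup>2"
      using intU intV intUV2 EU[of N] by (subst variance_eq) auto
    also have "\<dots> - s = expectation (\<lambda>\<omega>. (U N \<omega> + V N \<omega>)\<^sup>2 - (U N \<omega>)\<^sup>2) - (expectation (V N))\<^sup>2"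
      using EU2 elim(2) intU2 intUV2 by simp
    finally have "variance (\<lambda>\<omega>. sqrt (real N) * S N \<omega>) - s =
      expectation (\<lambda>\<omega>. (U N \<omega> + V N \<omega>)\<^sup>2 - (U N \<omega>)\<^sup>2) - (expectation (V N))\<^sup>2" .
    moreover have "\<bar>expectation (\<lambda>\<omega>. (U N \<omega> + V N \<omega>)\<^sup>2 - (U N \<omega>)\<^sup>2)\<bar>
        \<le> expectation (\<lambda>\<omega>. \<bar>(U N \<omega> + V N \<omega>)\<^sup>2 - (U N \<omega>)\<^sup>2\<bar>)"
      by (rule integral_abs_bound)
    moreover have "(expectation (V N))\<^sup>2 \<le> expectation (\<lambda>\<omega>. (V N \<omega>)\<^sup>2)"
      using variance_positive[of "V N"] variance_eq[OF intV] elim by simp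
    moreover have "0 \<le> (expectation (V N))\<^sup>2" by simp
    ultimately show ?case by linarith
  qed
  have "(\<lambda>N. variance (\<lambda>\<omega>. sqrt (real N) * S N \<omega>) - s) \<longlonglongrightarrow> 0"
    by (rule tendsto_rabs_zero_cancel,
        rule tendsto_sandwich[OF _ bound tendsto_const tendsto_add_zero[OF L1 V0]]) simp
  then show ?thesis
    unfolding s_def[symmetric] by (rule LIM_zero_cancel)
qed

section \<open>Deleting one observation\<close>

text \<open>
  Let \<open>p\<close> be the permutation of \<open>{1..N}\<close> such that reindexing by \<open>p\<close> moves the \<open>i\<close>-th entry to the end
  and keeps the order of the others.  The sample without its \<open>i\<close>-th entry consists of the first
  \<open>N - 1\<close> entries of the permuted sample, and \<open>f\<close> does not see the permutation.  So the left-hand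
  difference is the
  right-hand one evaluated at the permuted sample, which has the same distribution.
\<close>
lemma delete_one_distr:
  fixes f g :: "(nat \<Rightarrow> 'b) \<Rightarrow> real"
  assumes ind: "indep_vars (\<lambda>_. D) Z {1..N}"
    and same: "\<And>i j. i \<in> {1..N} \<Longrightarrow> j \<in> {1..N} \<Longrightarrow> distr M D (Z i) = distr M D (Z j)"
    and i: "i \<in> {1..N}"
    and f [measurable]: "f \<in> borel_measurable (\<Pi>\<^sub>M j\<in>{1..N}. D)"
    and g [measurable]: "g \<in> borel_measurable (\<Pi>\<^sub>M j\<in>{1..N - 1}. D)"
    and sym: "\<And>p z. p permutes {1..N} \<Longrightarrow> z \<in> extensional {1..N} \<Longrightarrow> f (\<lambda>j\<in>{1..N}. z (p j)) = f z"
  shows "distr M borel (\<lambda>\<omega>. g (\<lambda>j\<in>{1..N - 1}. Z (if j < i then j else j + 1) \<omega>) - f (\<lambda>j\<in>{1..N}. Z j \<omega>))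
    = distr M borel (\<lambda>\<omega>. g (\<lambda>j\<in>{1..N - 1}. Z j \<omega>) - f (\<lambda>j\<in>{1..N}. Z j \<omega>))"
proof -
  \<comment> \<open>The cycle \<open>(i i+1 ... N)\<close>.\<close>
  define p where "p j = (if j < i then j else if j < N then j + 1 else if j = N then i else j)" for j
  have p: "p permutes {1..N}"
  proof (rule bij_imp_permutes)
    have "inj_on p {1..N}"
      using i by (auto simp: inj_on_def p_def split: if_splits)
    moreover have "p ` {1..N} \<subseteq> {1..N}"
      using i by (auto simp: p_def)
    ultimately show "bij_betw p {1..N} {1..N}"
      by (simp add: bij_betw_def endo_inj_surj)
  qed (use i in \<open>auto simp: p_def\<close>)
  have pL: "p j \<in> {1..N}" if "j \<in> {1..N}" for j
    using p that by (simp only: permutes_in_image)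
  have Z [measurable]: "Z j \<in> M \<rightarrow>\<^sub>M D" if "j \<in> {1..N}" for j
    using ind that by (auto simp: indep_vars_def)
  define \<phi> where "\<phi> z = g (restrict z {1..N - 1}) - f z" for z
  have [measurable]: "(\<lambda>z. restrict z {1..N - 1}) \<in> (\<Pi>\<^sub>M j\<in>{1..N}. D) \<rightarrow>\<^sub>M (\<Pi>\<^sub>M j\<in>{1..N - 1}. D)"
    by (intro measurable_restrict_subset) auto
  have \<phi>: "\<phi> \<in> borel_measurable (\<Pi>\<^sub>M j\<in>{1..N}. D)"
    unfolding \<phi>_def by measurable
  have vec: "(\<lambda>\<omega>. \<lambda>j\<in>{1..N}. Z (q j) \<omega>) \<in> M \<rightarrow>\<^sub>M (\<Pi>\<^sub>M j\<in>{1..N}. D)"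
    if "\<And>j. j \<in> {1..N} \<Longrightarrow> q j \<in> {1..N}" for q
    using that by (intro measurable_restrict Z)
  have sub: "{1..N} \<inter> {1..N - 1} = {1..N - 1}" by auto
  have "g (\<lambda>j\<in>{1..N - 1}. Z (if j < i then j else j + 1) \<omega>) - f (\<lambda>j\<in>{1..N}. Z j \<omega>)
      = \<phi> (\<lambda>j\<in>{1..N}. Z (p j) \<omega>)" for \<omega>
  proof -
    have "(\<lambda>j\<in>{1..N - 1}. Z (if j < i then j else j + 1) \<omega>) = (\<lambda>j\<in>{1..N - 1}. Z (p j) \<omega>)"
      by (intro restrict_ext) (auto simp: p_def)
    moreover have "f (\<lambda>j\<in>{1..N}. Z j \<omega>) = f (\<lambda>j\<in>{1..N}. (\<lambda>j\<in>{1..N}. Z j \<omega>) (p j))"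
      by (rule sym[OF p, symmetric]) simp
    moreover have "(\<lambda>j\<in>{1..N}. (\<lambda>j\<in>{1..N}. Z j \<omega>) (p j)) = (\<lambda>j\<in>{1..N}. Z (p j) \<omega>)"
      using pL by (intro restrict_ext) auto
    ultimately show ?thesis
      by (simp add: \<phi>_def sub)
  qed
  then have "distr M borel (\<lambda>\<omega>. g (\<lambda>j\<in>{1..N - 1}. Z (if j < i then j else j + 1) \<omega>) - f (\<lambda>j\<in>{1..N}. Z j \<omega>))
      = distr (distr M (\<Pi>\<^sub>M j\<in>{1..N}. D) (\<lambda>\<omega>. \<lambda>j\<in>{1..N}. Z (p j) \<omega>)) borel \<phi>"
    using distr_distr[OF \<phi> vec[of p, OF pL]] by (simp only: comp_def)
  also have "\<dots> = distr (distr M (\<Pi>\<^sub>M j\<in>{1..N}. D) (\<lambda>\<omega>. \<lambda>j\<in>{1..N}. Z j \<omega>)) borel \<phi>"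
    using i by (subst iid_permuted_distr[OF ind _ same p]) auto
  also have "\<dots> = distr M borel (\<lambda>\<omega>. g (\<lambda>j\<in>{1..N - 1}. Z j \<omega>) - f (\<lambda>j\<in>{1..N}. Z j \<omega>))"
    using distr_distr[OF \<phi> vec[of "\<lambda>j. j"]] by (simp only: comp_def \<phi>_def sub restrict_restrict)
  finally show ?thesis .
qed

end

lemma sum_atLeastAtMost_skip:
  fixes x :: "nat \<Rightarrow> real"
  assumes "i \<in> {1..N}"
  shows "(\<Sum>j=1..N - 1. x (if j < i then j else j + 1)) = (\<Sum>j=1..N. x j) - x i"
proof -
  have "(\<Sum>j=1..N - 1. x (if j < i then j else j + 1)) = (\<Sum>j\<in>{1..N} - {i}. x j)"
    using assms
    by (intro sum.reindex_bij_witness[of _ "\<lambda>j. if j < i then j else j - 1" "\<lambda>j. if j < i then j else j + 1"]) auto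
  then show ?thesis
    using assms by (simp add: sum_diff1)
qed

text \<open>
  Here \<open>t i\<close> is a leave-one-out value: the mean of the \<open>x j\<close> with \<open>j \<noteq> i\<close>, a constant \<open>c\<close> common to all
  \<open>i\<close>, and an individual perturbation.  Centring removes \<open>c\<close>, and leaves
  \<open>- (x i - mean of x) / (N - 1)\<close> from the linear part.  The factor \<open>N - 1\<close> is then distributed as a
  square root over the two contributions.
\<close>
lemma jackknife_sum_squares:
  fixes x d t :: "nat \<Rightarrow> real"
  assumes N: "N \<ge> 2"
    and t: "\<And>i. i \<in> {1..N} \<Longrightarrow> t i = 1 / (real N - 1) * ((\<Sum>j=1..N. x j) - x i) + c + d i"
  shows "(real N - 1) * (\<Sum>i=1..N. (t i - 1 / real N * (\<Sum>j=1..N. t j))\<^sup>2)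
    = (\<Sum>i=1..N. (- (x i - (\<Sum>j=1..N. x j) / real N) / sqrt (real N - 1)
        + sqrt (real N - 1) * (d i - (\<Sum>j=1..N. d j) / real N))\<^sup>2)"
proof -
  define m where "m = real N - 1"
  have m: "m > 0" "real N = m + 1"
    using N by (auto simp: m_def)
  let ?x = "\<Sum>j=1..N. x j" and ?d = "\<Sum>j=1..N. d j"
  have "(\<Sum>j=1..N. t j) = (\<Sum>j=1..N. 1 / m * (?x - x j) + c + d j)"
    using t by (intro sum.cong) (auto simp: m_def)
  also have "\<dots> = 1 / m * (real N * ?x - ?x) + real N * c + ?d"
    by (simp add: sum.distrib sum_subtractf flip: sum_distrib_left sum_divide_distrib)
  also have "\<dots> = ?x + real N * c + ?d"
    using m by (simp add: field_simps)
  finally have sum_t: "(\<Sum>j=1..N. t j) = ?x + real N * c + ?d" .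
  have dev: "t i - 1 / real N * (\<Sum>j=1..N. t j) = - (x i - ?x / real N) / m + (d i - ?d / real N)"
    if "i \<in> {1..N}" for i
  proof -
    have "t i - 1 / real N * (\<Sum>j=1..N. t j) = 1 / m * (?x - x i) + c + d i - (?x / real N + c + ?d / real N)"
      unfolding sum_t using N t[OF that] by (simp add: add_divide_distrib m_def)
    moreover have "1 / m * (X - y) - X / real N = - (y - X / real N) / m" for X y
      unfolding m(2) minus_diff_eq using m(1) by (simp add: field_simps)
    note this[of ?x "x i"]
    ultimately show ?thesis
      by linarith
  qed
  have rescale: "m * (- a / m + b)\<^sup>2 = (- a / sqrt m + sqrt m * b)\<^sup>2" for a b
  proof -
    have "- a / sqrt m + sqrt m * b = sqrt m * (- a / m + b)"
      using m(1) real_div_sqrt[of m] by (simp add: field_simps)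
    then show ?thesis
      using m(1) by (simp add: power_mult_distrib)
  qed
  show ?thesis
    unfolding m_def[symmetric] sum_distrib_left[of m] by (intro sum.cong refl) (simp only: dev rescale)
qed

section \<open>The jackknife estimator in \<open>L\<^sup>1\<close>\<close>

context prob_space
begin

text \<open>
  Observations in an arbitrary measurable space suffice, as only the real values \<open>k (Z\<^sub>j)\<close> and the
  symmetry of the statistic enter the argument.  Two samples of equal size enter as a single sample of pairs, for which invariance under simultaneous
  permutations of both components is the relevant symmetry.
\<close>
lemma jackknife_variance_tendsto_L1:
  fixes Z :: "nat \<Rightarrow> 'a \<Rightarrow> 'b" and k :: "'b \<Rightarrow> real"
    and t :: "nat \<Rightarrow> (nat \<Rightarrow> 'b) \<Rightarrow> real" and R :: "nat \<Rightarrow> 'a \<Rightarrow> real"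
  assumes ind: "indep_vars (\<lambda>_. D) Z {1..}"
    and same: "\<And>i. i \<ge> 1 \<Longrightarrow> distr M D (Z i) = distr M D (Z 1)"
    and k [measurable]: "k \<in> borel_measurable D"
    and moment4: "integrable M (\<lambda>\<omega>. k (Z 1 \<omega>) ^ 4)"
    and mean: "expectation (\<lambda>\<omega>. k (Z 1 \<omega>)) = 0"
    and t_meas: "\<And>N. N \<ge> 1 \<Longrightarrow> t N \<in> borel_measurable (\<Pi>\<^sub>M j\<in>{1..N}. D)"
    and t_sym: "\<And>N p z. N \<ge> 1 \<Longrightarrow> p permutes {1..N} \<Longrightarrow> z \<in> extensional {1..N} \<Longrightarrow>
        t N (\<lambda>j\<in>{1..N}. z (p j)) = t N z"
    and decomposition: "\<And>N \<omega>. N \<ge> 1 \<Longrightarrow> \<omega> \<in> space M \<Longrightarrow>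
        t N (\<lambda>j\<in>{1..N}. Z j \<omega>) = 1 / real N * (\<Sum>j=1..N. k (Z j \<omega>)) + R N \<omega>"
    and R2: "\<forall>\<^sub>F N in sequentially. integrable M (\<lambda>\<omega>. (R N \<omega>)\<^sup>2)"
    and R_diff: "(\<lambda>N. (real N)\<^sup>2 * expectation (\<lambda>\<omega>. (R N \<omega> - R (N - 1) \<omega>)\<^sup>2)) \<longlonglongrightarrow> 0"
  defines "tm \<equiv> \<lambda>N i \<omega>. t (N - 1) (\<lambda>j\<in>{1..N - 1}. Z (if j < i then j else j + 1) \<omega>)"
  defines "J \<equiv> \<lambda>N \<omega>. (real N - 1) * (\<Sum>i=1..N. (tm N i \<omega> - 1 / real N * (\<Sum>j=1..N. tm N j \<omega>))\<^sup>2)"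
  defines "s \<equiv> expectation (\<lambda>\<omega>. (k (Z 1 \<omega>))\<^sup>2)"
  shows "\<forall>\<^sub>F N in sequentially. integrable M (J N)"
    and "(\<lambda>N. expectation (\<lambda>\<omega>. \<bar>J N \<omega> - s\<bar>)) \<longlonglongrightarrow> 0"
proof -
  have Z [measurable]: "Z i \<in> M \<rightarrow>\<^sub>M D" if "i \<ge> 1" for i
    using ind that by (auto simp: indep_vars_def)
  define Y where "Y = (\<lambda>j \<omega>. k (Z j \<omega>))"
  have Y_meas [measurable]: "Y j \<in> borel_measurable M" if "j \<ge> 1" for j
    unfolding Y_def using that by measurable
  have Y_ind: "indep_vars (\<lambda>_. borel) Y {1..}"
    unfolding Y_def by (rule indep_vars_compose2[OF ind]) (rule k)
  have Y_same: "distr M borel (Y i) = distr M borel (Y 1)" if "i \<ge> 1" for i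
  proof -
    have "distr M borel (Y j) = distr (distr M D (Z j)) borel k" if "j \<ge> 1" for j
      using that by (simp add: distr_distr Y_def comp_def)
    then show ?thesis
      using same[OF that] that by simp
  qed
  have Y2: "integrable M (\<lambda>\<omega>. (Y i \<omega>)\<^sup>2)" if "i \<ge> 1" for i
  proof -
    have "integrable M (\<lambda>\<omega>. (Y 1 \<omega>)\<^sup>2)"
      using moment4 by (intro square_integrable_imp_integrable[of "\<lambda>\<omega>. (Y 1 \<omega>)\<^sup>2"])
        (simp_all add: Y_def)
    then show ?thesis
      using identically_distributed_integral(2)[OF Y_same[OF that] Y_meas[OF that] Y_meas[OF order_refl],
          of "\<lambda>x. x\<^sup>2"] by simp
  qed

  \<comment> \<open>The remainder as a function of the sample; unlike \<open>R N\<close> it can be evaluated at samples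
    with a deleted entry.\<close>
  define r where "r N z = t N z - 1 / real N * (\<Sum>j=1..N. k (z j))" for N and z :: "nat \<Rightarrow> 'b"
  define rm where "rm N i \<omega> = r (N - 1) (\<lambda>j\<in>{1..N - 1}. Z (if j < i then j else j + 1) \<omega>)" for N i \<omega>
  define d where "d N i \<omega> = rm N i \<omega> - r N (\<lambda>j\<in>{1..N}. Z j \<omega>)" for N i \<omega>
  have r_meas: "r N \<in> borel_measurable (\<Pi>\<^sub>M j\<in>{1..N}. D)" if "N \<ge> 1" for N
    unfolding r_def
    by (intro borel_measurable_diff t_meas[OF that] borel_measurable_times borel_measurable_sum
        measurable_compose[OF _ k] measurable_component_singleton) auto
  have r_R: "r N (\<lambda>j\<in>{1..N}. Z j \<omega>) = R N \<omega>" if "N \<ge> 1" "\<omega> \<in> space M" for N \<omega>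
    using decomposition[OF that] by (simp add: r_def)
  have r_sym: "r N (\<lambda>j\<in>{1..N}. z (p j)) = r N z"
    if "N \<ge> 1" "p permutes {1..N}" "z \<in> extensional {1..N}" for N p z
  proof -
    have "(\<Sum>j=1..N. k (z (p j))) = (\<Sum>j=1..N. k (z j))"
      using sum.permute[OF that(2), of "\<lambda>j. k (z j)"] by (simp add: comp_def)
    then show ?thesis
      unfolding r_def t_sym[OF that] by (simp cong: sum.cong_simp)
  qed
  have vec: "(\<lambda>\<omega>. \<lambda>j\<in>{1..N}. Z (q j) \<omega>) \<in> M \<rightarrow>\<^sub>M (\<Pi>\<^sub>M j\<in>{1..N}. D)"
    if "\<And>j. j \<ge> 1 \<Longrightarrow> q j \<ge> 1" for N q
    using that by (intro measurable_restrict Z) auto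
  have R_meas: "R N \<in> borel_measurable M" if "N \<ge> 1" for N
  proof -
    have "(\<lambda>\<omega>. r N (\<lambda>j\<in>{1..N}. Z j \<omega>)) \<in> borel_measurable M"
      using measurable_compose[OF vec[of "\<lambda>j. j"] r_meas[OF that]] by simp
    then show ?thesis
      using r_R[OF that] by (simp cong: measurable_cong)
  qed
  have d_meas: "d N i \<in> borel_measurable M" if "N \<ge> 2" "i \<ge> 1" for N i
  proof -
    have "rm N i \<in> borel_measurable M"
      unfolding rm_def using that
      by (intro measurable_compose[OF vec r_meas]) auto
    moreover have "(\<lambda>\<omega>. r N (\<lambda>j\<in>{1..N}. Z j \<omega>)) \<in> borel_measurable M"
      using measurable_compose[OF vec[of "\<lambda>j. j"] r_meas] that by simp
    ultimately show ?thesis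
      unfolding d_def by (rule borel_measurable_diff)
  qed
  have d_distr: "distr M borel (d N i) = distr M borel (\<lambda>\<omega>. R (N - 1) \<omega> - R N \<omega>)"
    if "N \<ge> 2" "i \<in> {1..N}" for N i
  proof -
    have N: "N \<ge> 1" "N - 1 \<ge> 1"
      using that by auto
    have "distr M borel (d N i)
        = distr M borel (\<lambda>\<omega>. r (N - 1) (\<lambda>j\<in>{1..N - 1}. Z j \<omega>) - r N (\<lambda>j\<in>{1..N}. Z j \<omega>))"
      unfolding d_def rm_def
    proof (rule delete_one_distr)
      show "indep_vars (\<lambda>_. D) Z {1..N}"
        by (rule indep_vars_subset[OF ind]) auto
      show "distr M D (Z i) = distr M D (Z j)" if "i \<in> {1..N}" "j \<in> {1..N}" for i j
        using same[of i] same[of j] that by simp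
    qed (rule r_meas r_sym that(2) N | assumption)+
    also have "\<dots> = distr M borel (\<lambda>\<omega>. R (N - 1) \<omega> - R N \<omega>)"
      using that by (intro distr_cong refl) (simp add: r_R del: One_nat_def)
    finally show ?thesis .
  qed
  have Rdiff_meas: "(\<lambda>\<omega>. R (N - 1) \<omega> - R N \<omega>) \<in> borel_measurable M" if "N \<ge> 2" for N
    using that by (intro borel_measurable_diff R_meas) auto
  define e where "e N = expectation (\<lambda>\<omega>. (R N \<omega> - R (N - 1) \<omega>)\<^sup>2)" for N
  have d_moment: "expectation (\<lambda>\<omega>. (d N i \<omega>)\<^sup>2) = e N" if "N \<ge> 2" "i \<in> {1..N}" for N i
    using identically_distributed_integral(1)[OF d_distr[OF that] d_meas Rdiff_meas, of "\<lambda>x. x\<^sup>2"] that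
    by (simp add: e_def power2_commute)
  \<comment> \<open>Square integrability is known for large indices only, and is needed at \<open>N\<close> and \<open>N - 1\<close>.\<close>
  have d2: "\<forall>\<^sub>F N in sequentially. \<forall>i\<in>{1..N}. integrable M (\<lambda>\<omega>. (d N i \<omega>)\<^sup>2)"
  proof -
    have "\<forall>\<^sub>F N in sequentially. integrable M (\<lambda>\<omega>. (R (N - 1) \<omega>)\<^sup>2)"
      using eventually_compose_filterlim[OF R2 filterlim_minus_const_nat_at_top[of 1]] .
    with R2 show ?thesis
      using eventually_ge_at_top[of 2]
    proof eventually_elim
      case (elim N)
      then have "integrable M (\<lambda>\<omega>. (R (N - 1) \<omega> + (- R N \<omega>))\<^sup>2)"
        by (intro square_integrable_add borel_measurable_uminus R_meas) auto
      then show ?case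
        using identically_distributed_integral(2)[OF d_distr d_meas Rdiff_meas, of N _ "\<lambda>x. x\<^sup>2"] elim
        by simp
    qed
  qed

  define u where "u = (\<lambda>N i \<omega>. - (Y i \<omega> - (\<Sum>j=1..N. Y j \<omega>) / real N) / sqrt (real N - 1))"
  define v where "v = (\<lambda>N i \<omega>. sqrt (real N - 1) * (d N i \<omega> - (\<Sum>j=1..N. d N j \<omega>) / real N))"
  have J_eq: "J N \<omega> = (\<Sum>i=1..N. (u N i \<omega> + v N i \<omega>)\<^sup>2)" if "N \<ge> 2" for N \<omega>
    unfolding J_def u_def v_def
  proof (rule jackknife_sum_squares[OF that])
    fix i assume i: "i \<in> {1..N}"
    have "(\<Sum>j=1..N - 1. k ((\<lambda>j\<in>{1..N - 1}. Z (if j < i then j else j + 1) \<omega>) j))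
        = (\<Sum>j=1..N - 1. Y (if j < i then j else j + 1) \<omega>)"
      by (intro sum.cong) (auto simp: Y_def)
    also have "\<dots> = (\<Sum>j=1..N. Y j \<omega>) - Y i \<omega>"
      by (rule sum_atLeastAtMost_skip[OF i])
    finally show "tm N i \<omega> = 1 / (real N - 1) * ((\<Sum>j=1..N. Y j \<omega>) - Y i \<omega>)
        + r N (\<lambda>j\<in>{1..N}. Z j \<omega>) + d N i \<omega>"
      using that by (simp add: d_def rm_def tm_def r_def[of "N - 1"] of_nat_diff del: One_nat_def)
  qed
  have u_meas: "u N i \<in> borel_measurable M" if "i \<ge> 1" for N i
    unfolding u_def using that by measurable
  have v_meas: "v N i \<in> borel_measurable M" if "N \<ge> 2" "i \<ge> 1" for N i
    unfolding v_def using d_meas[OF that(1)] that(2)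
    by (intro borel_measurable_times borel_measurable_diff borel_measurable_divide borel_measurable_sum) auto
  have deviation_sq: "integrable M (\<lambda>\<omega>. (f i \<omega> - (\<Sum>j=1..N. f j \<omega>) / real N)\<^sup>2)"
    if "\<And>j. j \<in> {1..N} \<Longrightarrow> f j \<in> borel_measurable M"
      "\<And>j. j \<in> {1..N} \<Longrightarrow> integrable M (\<lambda>\<omega>. (f j \<omega>)\<^sup>2)" "i \<in> {1..N}"
    for f :: "nat \<Rightarrow> 'a \<Rightarrow> real" and N i
  proof -
    have "integrable M (\<lambda>\<omega>. (- (1 / real N) * (\<Sum>j=1..N. f j \<omega>))\<^sup>2)"
      unfolding power_mult_distrib using that
      by (intro integrable_mult_right square_integrable_sum) auto
    then have "integrable M (\<lambda>\<omega>. (f i \<omega> + - (1 / real N) * (\<Sum>j=1..N. f j \<omega>))\<^sup>2)"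
      using that by (intro square_integrable_add borel_measurable_times borel_measurable_sum) auto
    then show ?thesis by simp
  qed
  have u2: "integrable M (\<lambda>\<omega>. (u N i \<omega>)\<^sup>2)" if "i \<in> {1..N}" for N i
    unfolding u_def power_divide power2_minus
    using that Y2 by (intro integrable_divide deviation_sq) auto
  have v2: "\<forall>\<^sub>F N in sequentially. \<forall>i\<in>{1..N}. integrable M (\<lambda>\<omega>. (v N i \<omega>)\<^sup>2)"
    using d2 eventually_ge_at_top[of 2]
  proof eventually_elim
    case (elim N)
    then show ?case
      unfolding v_def power_mult_distrib
      by (intro ballI integrable_mult_right deviation_sq d_meas) auto
  qed
  have reg: "\<forall>\<^sub>F N in sequentially. \<forall>i\<in>{1..N}. u N i \<in> borel_measurable M \<and> v N i \<in> borel_measurable M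
      \<and> integrable M (\<lambda>\<omega>. (u N i \<omega>)\<^sup>2) \<and> integrable M (\<lambda>\<omega>. (v N i \<omega>)\<^sup>2)"
    using v2 eventually_ge_at_top[of 2]
    by eventually_elim (use u_meas v_meas u2 in auto)
  have u_sum: "(\<Sum>i=1..N. (u N i \<omega>)\<^sup>2)
      = 1 / (real N - 1) * (\<Sum>i=1..N. (Y i \<omega> - (\<Sum>j=1..N. Y j \<omega>) / real N)\<^sup>2)" if "N \<ge> 2" for N \<omega>
    unfolding sum_distrib_left[of "1 / (real N - 1)"] using that
    by (intro sum.cong) (simp_all add: u_def power_divide del: minus_diff_eq)
  have u_L1: "(\<lambda>N. expectation (\<lambda>\<omega>. \<bar>(\<Sum>i=1..N. (u N i \<omega>)\<^sup>2) - s\<bar>)) \<longlonglongrightarrow> 0"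
  proof (rule Lim_transform_eventually)
    show "(\<lambda>N. expectation (\<lambda>\<omega>.
      \<bar>1 / (real N - 1) * (\<Sum>i=1..N. (Y i \<omega> - (\<Sum>j=1..N. Y j \<omega>) / real N)\<^sup>2) - s\<bar>)) \<longlonglongrightarrow> 0"
      using sample_variance_tendsto_L1[OF Y_ind Y_same] moment4 mean by (simp add: Y_def s_def)
    show "\<forall>\<^sub>F N in sequentially. expectation (\<lambda>\<omega>.
        \<bar>1 / (real N - 1) * (\<Sum>i=1..N. (Y i \<omega> - (\<Sum>j=1..N. Y j \<omega>) / real N)\<^sup>2) - s\<bar>)
        = expectation (\<lambda>\<omega>. \<bar>(\<Sum>i=1..N. (u N i \<omega>)\<^sup>2) - s\<bar>)"
      using eventually_ge_at_top[of 2] by eventually_elim (simp only: u_sum)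
  qed
  have u_int: "integrable M (\<lambda>\<omega>. \<Sum>i=1..N. (u N i \<omega>)\<^sup>2)" for N
    using u2 by (intro Bochner_Integration.integrable_sum)
  have u_lim: "(\<lambda>N. expectation (\<lambda>\<omega>. \<Sum>i=1..N. (u N i \<omega>)\<^sup>2)) \<longlonglongrightarrow> s"
    using expectation_tendsto_of_L1[OF always_eventually u_L1] u_int by simp
  have v_lim: "(\<lambda>N. expectation (\<lambda>\<omega>. \<Sum>i=1..N. (v N i \<omega>)\<^sup>2)) \<longlonglongrightarrow> 0"
  proof (rule tendsto_sandwich[OF _ _ tendsto_const R_diff])
    show "\<forall>\<^sub>F N in sequentially. expectation (\<lambda>\<omega>. \<Sum>i=1..N. (v N i \<omega>)\<^sup>2)
        \<le> (real N)\<^sup>2 * expectation (\<lambda>\<omega>. (R N \<omega> - R (N - 1) \<omega>)\<^sup>2)"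
      using d2 v2 eventually_ge_at_top[of 2]
    proof eventually_elim
      case (elim N)
      have "expectation (\<lambda>\<omega>. \<Sum>i=1..N. (v N i \<omega>)\<^sup>2)
          \<le> expectation (\<lambda>\<omega>. (real N - 1) * (\<Sum>i=1..N. (d N i \<omega>)\<^sup>2))"
      proof (rule integral_mono)
        show "integrable M (\<lambda>\<omega>. \<Sum>i=1..N. (v N i \<omega>)\<^sup>2)"
          using elim by (intro Bochner_Integration.integrable_sum) auto
        show "integrable M (\<lambda>\<omega>. (real N - 1) * (\<Sum>i=1..N. (d N i \<omega>)\<^sup>2))"
          using elim by (intro integrable_mult_right Bochner_Integration.integrable_sum) auto
        fix \<omega>
        have "(\<Sum>i=1..N. (v N i \<omega>)\<^sup>2)
            = (real N - 1) * (\<Sum>i=1..N. (d N i \<omega> - (\<Sum>j=1..N. d N j \<omega>) / real N)\<^sup>2)"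
          using elim(3) by (simp add: v_def power_mult_distrib sum_distrib_left)
        also have "\<dots> \<le> (real N - 1) * (\<Sum>i=1..N. (d N i \<omega>)\<^sup>2)"
          using sum_sq_deviation(1)[of "{1..N}" "\<lambda>i. d N i \<omega>"] elim(3)
          by (intro mult_left_mono) auto
        finally show "(\<Sum>i=1..N. (v N i \<omega>)\<^sup>2) \<le> (real N - 1) * (\<Sum>i=1..N. (d N i \<omega>)\<^sup>2)" .
      qed
      also have "\<dots> = (real N - 1) * (\<Sum>i=1..N. expectation (\<lambda>\<omega>. (d N i \<omega>)\<^sup>2))"
        using elim by simp
      also have "\<dots> = (real N - 1) * (real N * e N)"
        using d_moment[OF elim(3)] by simp
      also have "\<dots> \<le> real N * (real N * e N)"
        by (intro mult_right_mono) (auto simp: e_def)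
      finally show ?case
        by (simp add: e_def power2_eq_square mult.assoc)
    qed
  qed (simp add: sum_nonneg)
  have perturbed: "(\<lambda>N. expectation (\<lambda>\<omega>. \<bar>(\<Sum>i=1..N. (u N i \<omega> + v N i \<omega>)\<^sup>2) - (\<Sum>i=1..N. (u N i \<omega>)\<^sup>2)\<bar>))
      \<longlonglongrightarrow> 0"
    by (rule tendsto_integral_sum_squares_perturbed[OF _ reg u_lim v_lim]) simp
  have uv_int: "\<forall>\<^sub>F N in sequentially. integrable M (\<lambda>\<omega>. \<Sum>i=1..N. (u N i \<omega> + v N i \<omega>)\<^sup>2)"
    using reg by eventually_elim (auto intro!: Bochner_Integration.integrable_sum square_integrable_add)
  show "\<forall>\<^sub>F N in sequentially. integrable M (J N)"
    using uv_int eventually_ge_at_top[of 2]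
  proof eventually_elim
    case (elim N)
    show ?case
      by (rule iffD2[OF Bochner_Integration.integrable_cong[OF refl J_eq[OF elim(2)]] elim(1)])
  qed
  show "(\<lambda>N. expectation (\<lambda>\<omega>. \<bar>J N \<omega> - s\<bar>)) \<longlonglongrightarrow> 0"
  proof (rule tendsto_sandwich[OF _ _ tendsto_const tendsto_add_zero[OF perturbed u_L1]])
    show "\<forall>\<^sub>F N in sequentially. expectation (\<lambda>\<omega>. \<bar>J N \<omega> - s\<bar>)
      \<le> expectation (\<lambda>\<omega>. \<bar>(\<Sum>i=1..N. (u N i \<omega> + v N i \<omega>)\<^sup>2) - (\<Sum>i=1..N. (u N i \<omega>)\<^sup>2)\<bar>)
        + expectation (\<lambda>\<omega>. \<bar>(\<Sum>i=1..N. (u N i \<omega>)\<^sup>2) - s\<bar>)"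
      using uv_int eventually_ge_at_top[of 2]
    proof eventually_elim
      case (elim N)
      let ?A = "\<lambda>\<omega>. \<Sum>i=1..N. (u N i \<omega> + v N i \<omega>)\<^sup>2" and ?B = "\<lambda>\<omega>. \<Sum>i=1..N. (u N i \<omega>)\<^sup>2"
      have "expectation (\<lambda>\<omega>. \<bar>?A \<omega> - s\<bar>) \<le> expectation (\<lambda>\<omega>. \<bar>?A \<omega> - ?B \<omega>\<bar> + \<bar>?B \<omega> - s\<bar>)"
        using elim(1) u_int by (intro integral_mono) auto
      also have "\<dots> = expectation (\<lambda>\<omega>. \<bar>?A \<omega> - ?B \<omega>\<bar>) + expectation (\<lambda>\<omega>. \<bar>?B \<omega> - s\<bar>)"
        using elim(1) u_int by (intro Bochner_Integration.integral_add) auto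
      finally show ?case
        by (simp only: J_eq[OF elim(2)])
    qed
  qed simp
qed

end

section \<open>Two samples of equal size\<close>

text \<open>
  The pairs are disjoint blocks of an independent family.
\<close>
lemma two_iid_samples_pair_obs:
  assumes "two_iid_samples M F X"
  shows "prob_space.indep_vars M (\<lambda>_. borel) (pair_obs X) {1..}"
    and "j \<ge> 1 \<Longrightarrow> distr M borel (pair_obs X j) = F 1 \<Otimes>\<^sub>M F 2"
proof -
  interpret prob_space M
    using assms by (simp add: two_iid_samples_def)
  have ind: "indep_vars (\<lambda>_. borel) (\<lambda>(i, j). X i j) ({1, 2} \<times> {1..})"
    using assms by (simp add: two_iid_samples_def)
  have "indep_vars (\<lambda>j. \<Pi>\<^sub>M k\<in>{1, 2} \<times> {j}. borel)
      (\<lambda>j \<omega>. \<lambda>k\<in>{1, 2} \<times> {j}. (case k of (i, j) \<Rightarrow> X i j) \<omega>) {1..}"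
    by (rule indep_vars_restrict[OF ind]) (auto simp: disjoint_family_on_def)
  then have "indep_vars (\<lambda>_. borel) (\<lambda>j \<omega>. (\<lambda>x. (x (1, j), x (2, j)))
      (\<lambda>k\<in>{1, 2} \<times> {j}. (case k of (i, j) \<Rightarrow> X i j) \<omega>)) {1..}"
    by (rule indep_vars_compose2) (simp add: borel_prod[symmetric])
  then show "indep_vars (\<lambda>_. borel) (pair_obs X) {1..}"
    by (simp add: pair_obs_def[abs_def])
  assume j: "j \<ge> 1"
  have "indep_var (\<Pi>\<^sub>M k\<in>{(1, j)}. borel) (\<lambda>\<omega>. \<lambda>k\<in>{(1, j)}. (case k of (i, j) \<Rightarrow> X i j) \<omega>)
      (\<Pi>\<^sub>M k\<in>{(2, j)}. borel) (\<lambda>\<omega>. \<lambda>k\<in>{(2, j)}. (case k of (i, j) \<Rightarrow> X i j) \<omega>)"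
    using j by (intro indep_var_restrict[OF ind]) auto
  then have "indep_var borel ((\<lambda>x. x (1, j)) \<circ> (\<lambda>\<omega>. \<lambda>k\<in>{(1, j)}. (case k of (i, j) \<Rightarrow> X i j) \<omega>))
      borel ((\<lambda>x. x (2, j)) \<circ> (\<lambda>\<omega>. \<lambda>k\<in>{(2, j)}. (case k of (i, j) \<Rightarrow> X i j) \<omega>))"
    by (rule indep_var_compose) auto
  then have "indep_var borel (X 1 j) borel (X 2 j)"
    by (simp add: comp_def)
  then show "distr M borel (pair_obs X j) = F 1 \<Otimes>\<^sub>M F 2"
    using assms j unfolding indep_var_distribution_eq
    by (simp add: two_iid_samples_def pair_obs_def[abs_def] borel_prod)
qed

theorem theorem2p2:
  fixes M :: "'a measure"
    and F :: "nat \<Rightarrow> real measure"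
    and X :: "nat \<Rightarrow> nat \<Rightarrow> 'a \<Rightarrow> real"
    and T :: "nat \<Rightarrow> (nat \<Rightarrow> real \<times> real) \<Rightarrow> real"
    and R :: "nat \<Rightarrow> 'a \<Rightarrow> real"
    and h :: "nat \<Rightarrow> real \<Rightarrow> real"
  assumes samples: "two_iid_samples M F X"
    and statistic: "two_sample_statistic T"
    and h_meas: "\<And>i. i \<in> {1, 2} \<Longrightarrow> h i \<in> borel_measurable borel"
    and h_moment4: "\<And>i. i \<in> {1, 2} \<Longrightarrow> integrable (F i) (\<lambda>x. h i x ^ 4)"
    and xi_centered: "prob_space.expectation M (\<lambda>\<omega>. xi h (pair_obs X 1 \<omega>)) = 0"
    and decomposition: "\<And>N \<omega>. N \<ge> 1 \<Longrightarrow> \<omega> \<in> space M \<Longrightarrow>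
          stat T X N \<omega> = 1 / real N * (\<Sum>j=1..N. xi h (pair_obs X j \<omega>)) + R N \<omega>"
    and R_square_integrable: "\<forall>\<^sub>F N in sequentially. integrable M (\<lambda>\<omega>. (R N \<omega>)\<^sup>2)"
    and R_small: "(\<lambda>N. real N * prob_space.expectation M (\<lambda>\<omega>. (R N \<omega>)\<^sup>2)) \<longlonglongrightarrow> 0"
    and R_diff_small:
      "(\<lambda>N. (real N)\<^sup>2 * prob_space.expectation M (\<lambda>\<omega>. (R N \<omega> - R (N - 1) \<omega>)\<^sup>2)) \<longlonglongrightarrow> 0"
    and avar_pos: "asymptotic_variance M T X > 0"
  shows "tendsto_in_prob M
           (\<lambda>N \<omega>. jackknife_sigma2 T X N \<omega> / asymptotic_variance M T X) 1
       \<and> (\<lambda>N. prob_space.expectation M (jackknife_sigma2 T X N) / asymptotic_variance M T X)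
           \<longlonglongrightarrow> 1
       \<and> tendsto_in_prob M
           (\<lambda>N \<omega>. jackknife_var T X N \<omega> / prob_space.variance M (stat T X N)) 1
       \<and> (\<lambda>N. prob_space.expectation M (jackknife_var T X N)
               / prob_space.variance M (stat T X N))
           \<longlonglongrightarrow> 1"
proof -
  interpret prob_space M
    using samples by (simp add: two_iid_samples_def)
  let ?Z = "pair_obs X" and ?Y = "\<lambda>j \<omega>. xi h (pair_obs X j \<omega>)"
  define s where "s = expectation (\<lambda>\<omega>. (?Y 1 \<omega>)\<^sup>2)"
  note Z_ind = two_iid_samples_pair_obs(1)[OF samples]
  have Z_same: "distr M borel (?Z i) = distr M borel (?Z 1)" if "i \<ge> 1" for i
    using two_iid_samples_pair_obs(2)[OF samples] that by simp
  have Z [measurable]: "?Z j \<in> borel_measurable M" if "j \<ge> 1" for j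
    using Z_ind that by (auto simp: indep_vars_def)
  have [measurable]: "h 1 \<in> borel_measurable borel" "h 2 \<in> borel_measurable borel"
    using h_meas by auto
  have xi_meas [measurable]: "xi h \<in> borel_measurable borel"
    unfolding xi_def borel_prod[symmetric] by measurable
  have Y_ind: "indep_vars (\<lambda>_. borel) ?Y {1..}"
    by (rule indep_vars_compose2[OF Z_ind]) (rule xi_meas)
  have Y_same: "distr M borel (?Y i) = distr M borel (?Y 1)" if "i \<ge> 1" for i
  proof -
    have "distr M borel (?Y j) = distr (distr M borel (?Z j)) borel (xi h)" if "j \<ge> 1" for j
      using that by (simp add: distr_distr comp_def)
    then show ?thesis
      using Z_same[OF that] that by simp
  qed
  have Y4: "integrable M (\<lambda>\<omega>. ?Y 1 \<omega> ^ 4)"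
  proof (rule Bochner_Integration.integrable_bound)
    have h4: "integrable M (\<lambda>\<omega>. h i (X i 1 \<omega>) ^ 4)" if "i \<in> {1, 2}" for i
    proof -
      have "random_variable borel (X i 1)"
        using samples that by (auto simp: two_iid_samples_def indep_vars_def)
      moreover have "distr M borel (X i 1) = F i"
        using samples that unfolding two_iid_samples_def by blast
      ultimately show ?thesis
        using h_moment4[OF that] h_meas[OF that] integrable_distr_eq[of "X i 1" M borel "\<lambda>x. h i x ^ 4"]
        by simp
    qed
    then show "integrable M (\<lambda>\<omega>. h 1 (X 1 1 \<omega>) ^ 4 + h 2 (X 2 1 \<omega>) ^ 4)"
      by simp
    \<comment> \<open>Convexity of the square, applied to \<open>a, b\<close> and then to \<open>a\<^sup>2, b\<^sup>2\<close>.\<close>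
    have "(1 / 2 * (a + b)) ^ 4 \<le> a ^ 4 + b ^ 4" for a b :: real
    proof -
      have sq: "(1 / 2 * (c + d))\<^sup>2 \<le> 1 / 2 * (c\<^sup>2 + d\<^sup>2)" for c d :: real
        using sum_squares_bound[of c d] by (simp add: power2_eq_square field_simps)
      have "(1 / 2 * (a + b)) ^ 4 = ((1 / 2 * (a + b))\<^sup>2)\<^sup>2"
        by (simp flip: power_mult)
      also have "\<dots> \<le> (1 / 2 * (a\<^sup>2 + b\<^sup>2))\<^sup>2"
        using sq by (rule power_mono) simp
      also have "\<dots> \<le> 1 / 2 * ((a\<^sup>2)\<^sup>2 + (b\<^sup>2)\<^sup>2)"
        by (rule sq)
      also have "\<dots> \<le> a ^ 4 + b ^ 4"
        by (simp add: add_nonneg_nonneg flip: power_mult)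
      finally show ?thesis .
    qed
    then show "AE \<omega> in M. norm (?Y 1 \<omega> ^ 4) \<le> norm (h 1 (X 1 1 \<omega>) ^ 4 + h 2 (X 2 1 \<omega>) ^ 4)"
      by (intro AE_I2) (simp add: xi_def pair_obs_def)
  qed measurable
  have Y2: "integrable M (\<lambda>\<omega>. (?Y 1 \<omega>)\<^sup>2)"
    using Y4 by (intro square_integrable_imp_integrable[of "\<lambda>\<omega>. (?Y 1 \<omega>)\<^sup>2"]) simp_all

  have T_meas: "T N \<in> borel_measurable (\<Pi>\<^sub>M j\<in>{1..N}. borel)" if "N \<ge> 1" for N
    using statistic that by (simp add: two_sample_statistic_def)
  have T_sym: "T N (\<lambda>j\<in>{1..N}. z (p j)) = T N z"
    if "N \<ge> 1" "p permutes {1..N}" "z \<in> extensional {1..N}" for N p z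
  proof -
    have "two_sample_symmetric N (T N)"
      using statistic that by (simp add: two_sample_statistic_def)
    then have "T N (\<lambda>j\<in>{1..N}. (fst (z (p j)), snd (z (p j)))) = T N z"
      using that unfolding two_sample_symmetric_def by blast
    then show ?thesis by simp
  qed

  have J_eq: "jackknife_sigma2 T X N \<omega> = (real N - 1) * (\<Sum>i=1..N.
      (T (N - 1) (\<lambda>j\<in>{1..N - 1}. ?Z (if j < i then j else j + 1) \<omega>)
       - 1 / real N * (\<Sum>j=1..N. T (N - 1) (\<lambda>l\<in>{1..N - 1}. ?Z (if l < j then l else l + 1) \<omega>)))\<^sup>2)"
    for N \<omega>
    by (simp only: jackknife_sigma2_def stat_leave_out_mean_def stat_leave_out_def)
  note J = jackknife_variance_tendsto_L1[OF Z_ind Z_same xi_meas Y4 xi_centered T_meas T_sym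
      decomposition[unfolded stat_def] R_square_integrable R_diff_small, folded J_eq s_def]
  have J_int: "\<forall>\<^sub>F N in sequentially. integrable M (jackknife_sigma2 T X N)"
    using J(1) by simp
  have J_L1: "(\<lambda>N. expectation (\<lambda>\<omega>. \<bar>jackknife_sigma2 T X N \<omega> - s\<bar>)) \<longlonglongrightarrow> 0"
    using J(2) by simp

  have R_meas: "R N \<in> borel_measurable M" if "N \<ge> 1" for N
  proof -
    have "(\<lambda>\<omega>. \<lambda>j\<in>{1..N}. ?Z j \<omega>) \<in> M \<rightarrow>\<^sub>M (\<Pi>\<^sub>M j\<in>{1..N}. borel)"
      by (intro measurable_restrict Z) auto
    from measurable_compose[OF this T_meas[OF that]]
    have "stat T X N \<in> borel_measurable M"
      by (simp only: stat_def[abs_def])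
    then have "(\<lambda>\<omega>. stat T X N \<omega> - 1 / real N * (\<Sum>j=1..N. ?Y j \<omega>)) \<in> borel_measurable M"
      by (intro borel_measurable_diff borel_measurable_times borel_measurable_sum) auto
    then show ?thesis
      using decomposition[OF that] by (simp cong: measurable_cong)
  qed
  have R_reg: "\<forall>\<^sub>F N in sequentially. R N \<in> borel_measurable M \<and> integrable M (\<lambda>\<omega>. (R N \<omega>)\<^sup>2)"
    using R_square_integrable eventually_ge_at_top[of 1] by eventually_elim (use R_meas in auto)
  have var_lim: "(\<lambda>N. variance (\<lambda>\<omega>. sqrt (real N) * stat T X N \<omega>)) \<longlonglongrightarrow> s"
    unfolding s_def
    by (rule scaled_variance_tendsto[OF Y_ind Y_same Y2 xi_centered R_reg R_small decomposition])
  then have avar: "asymptotic_variance M T X = s"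
    unfolding asymptotic_variance_def by (rule limI)
  have s_pos: "s > 0"
    using avar_pos by (simp add: avar)
  have "variance (\<lambda>\<omega>. sqrt (real N) * stat T X N \<omega>) = real N * variance (stat T X N)" for N
    by (simp add: power_mult_distrib flip: right_diff_distrib)
  with var_lim have var_lim': "(\<lambda>N. real N * variance (stat T X N)) \<longlonglongrightarrow> s"
    by simp
  \<comment> \<open>This includes \<open>N = 0\<close>, where division by zero makes both sides vanish.\<close>
  have Jvar: "jackknife_var T X N = (\<lambda>\<omega>. jackknife_sigma2 T X N \<omega> / real N)" for N
    by (simp add: jackknife_var_def jackknife_sigma2_def fun_eq_iff)
  show ?thesis
    using ratio_consistent[OF J_int J_L1 tendsto_const s_pos]
      ratio_consistent[OF J_int J_L1 var_lim' s_pos]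
    by (simp add: avar Jvar)
qed

end
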